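(* Let $G$ be a countable amenable group, let $X \subset \mathcal{A}^G$ be a $G$-subshift over a finite alphabet $\mathcal{A}$, let $F \subset G$ be finite, let $v, w \in L_F(X)$, and let $\mu$ be a measure of maximal entropy on $X$. If $E_X(v) \subset E_X(w)$, then $\mu([v]) \leq \mu([w])$.
   Context: $\mathcal{A}$ is a finite set with the discrete topology and $\mathcal{A}^G$ has the product topology. For $g \in G$ and $x \in \mathcal{A}^G$, $\sigma_g(x)_h = x_{gh}$ for all $h \in G$. A $G$-subshift is a closed set $X \subset \mathcal{A}^G$ with $\sigma_g(X) \subset X$ for all $g \in G$. For $H\subset G$, $x_H$ is the restriction of $x$ to $H$, and $F^c = G \setminus F$. For finite $F \subset G$, $L_F(X) = \{x_F : x \in X\}$. For $w \in L_F(X)$, $[w] = \{x \in X : x_F = w\}$ and $E_X(w) = \{\eta \in \mathcal{A}^{F^c} : w\eta \in X\}$, where $w\eta$ equals $w$ on $F$ and $\eta$ on $F^c$. A measure of maximal entropy is a $\sigma$-invariant Borel probability measure on $X$ maximizing the Kolmogorov–Sinai entropy $h(\mu)$ (with respect to the $G$-action) among all $\sigma$-invariant Borel probability measures on $X$ (equivalently, an equilibrium state for the potential $\phi = 0$). *)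

theory Defs
  imports "HOL-Probability.Probability"
begin

text \<open>
  A countable group \<open>G\<close> is a type \<open>'g\<close> of classes \<open>group_add\<close> and \<open>countable\<close>.  The class
  \<open>group_add\<close> does not assume commutativity; the product \<open>gh\<close> is written \<open>g + h\<close>.
  The alphabet is a type of classes \<open>finite\<close> and \<open>discrete_topology\<close>; then \<open>'g \<Rightarrow> 'a\<close> carries the
  product topology, and \<open>borel\<close> is its Borel sigma-algebra.
\<close>

subsection \<open>Subshifts\<close>

definition shift :: "'g::group_add \<Rightarrow> ('g \<Rightarrow> 'a) \<Rightarrow> ('g \<Rightarrow> 'a)"
  where "shift g x = (\<lambda>h. x (g + h))"

definition subshift :: "('g::group_add \<Rightarrow> 'a::discrete_topology) set \<Rightarrow> bool"
  where "subshift X \<longleftrightarrow> closed X \<and> (\<forall>g. shift g ` X \<subseteq> X)"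

text \<open>
  Patterns on a set \<open>S\<close> of sites are elements of \<open>S \<rightarrow>\<^sub>E UNIV\<close>, that is, functions on the whole
  group that are \<open>undefined\<close> outside \<open>S\<close>.
\<close>

definition language :: "'g set \<Rightarrow> ('g \<Rightarrow> 'a) set \<Rightarrow> ('g \<Rightarrow> 'a) set"
  where "language F X = (\<lambda>x. restrict x F) ` X"

definition cylinder :: "('g \<Rightarrow> 'a) set \<Rightarrow> 'g set \<Rightarrow> ('g \<Rightarrow> 'a) \<Rightarrow> ('g \<Rightarrow> 'a) set"
  where "cylinder X F w = {x \<in> X. restrict x F = w}"

definition extender_set :: "('g \<Rightarrow> 'a) set \<Rightarrow> 'g set \<Rightarrow> ('g \<Rightarrow> 'a) \<Rightarrow> ('g \<Rightarrow> 'a) set"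
  where "extender_set X F w = {\<eta> \<in> (- F) \<rightarrow>\<^sub>E UNIV. override_on \<eta> w F \<in> X}"

subsection \<open>Amenability\<close>

text \<open>
  Since \<^term>\<open>shift g \<circ> shift k = shift (k + g)\<close>, the joins used for entropy below
  are invariant under \<open>F \<mapsto> gF\<close>, so the relevant Foelner sequences are the
  asymptotically right-invariant ones.  Inversion \<open>F \<mapsto> F\<^sup>-\<^sup>1\<close> exchanges these with the
  asymptotically left-invariant ones, so the notion of amenability does not depend on the side.
\<close>

definition folner_sequence :: "(nat \<Rightarrow> 'g::group_add set) \<Rightarrow> bool"
  where "folner_sequence \<Phi> \<longleftrightarrow>
    (\<forall>n. finite (\<Phi> n) \<and> \<Phi> n \<noteq> {}) \<and>
    (\<forall>g. (\<lambda>n. real (card (sym_diff ((\<lambda>h. h + g) ` \<Phi> n) (\<Phi> n)))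
              / real (card (\<Phi> n))) \<longlonglongrightarrow> 0)"

definition amenable :: "'g::{group_add, countable} itself \<Rightarrow> bool"
  where "amenable _ \<longleftrightarrow> (\<exists>\<Phi> :: nat \<Rightarrow> 'g set. folner_sequence \<Phi>)"

subsection \<open>Kolmogorov--Sinai entropy\<close>

definition invariant_measure ::
    "('g::group_add \<Rightarrow> 'a::discrete_topology) set \<Rightarrow> ('g \<Rightarrow> 'a) measure \<Rightarrow> bool"
  where "invariant_measure X \<mu> \<longleftrightarrow>
    prob_space \<mu> \<and> sets \<mu> = sets (restrict_space borel X) \<and>
    (\<forall>g. distr \<mu> \<mu> (shift g) = \<mu>)"

definition finite_partition :: "'x measure \<Rightarrow> 'x set set \<Rightarrow> bool"
  where "finite_partition M P \<longleftrightarrow> finite P \<and> P \<subseteq> sets M \<and> partition_on (space M) P"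

text \<open>
  The join of the partitions \<open>\<sigma>\<^sub>g\<^sup>-\<^sup>1 P\<close>, \<open>g \<in> F\<close>.  It may contain the empty set, which does not
  contribute to the entropy.
\<close>

definition join_partition ::
    "('g::group_add \<Rightarrow> 'a) measure \<Rightarrow> ('g \<Rightarrow> 'a) set set \<Rightarrow> 'g set \<Rightarrow> ('g \<Rightarrow> 'a) set set"
  where "join_partition \<mu> P F =
    (\<lambda>p. {x \<in> space \<mu>. \<forall>g\<in>F. shift g x \<in> p g}) ` (F \<rightarrow>\<^sub>E P)"

text \<open>Note \<^prop>\<open>0 * ln 0 = (0::real)\<close>.\<close>

definition shannon_entropy :: "'x measure \<Rightarrow> 'x set set \<Rightarrow> real"
  where "shannon_entropy M P = - (\<Sum>A\<in>P. measure M A * ln (measure M A))"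

text \<open>
  The limit exists along every Foelner sequence and does not depend on the sequence
  (Ornstein--Weiss); the definition picks the common value.
\<close>

definition partition_entropy_rate ::
    "('g::group_add \<Rightarrow> 'a) measure \<Rightarrow> ('g \<Rightarrow> 'a) set set \<Rightarrow> real"
  where "partition_entropy_rate \<mu> P =
    (THE h. \<forall>\<Phi>. folner_sequence \<Phi> \<longrightarrow>
       (\<lambda>n. shannon_entropy \<mu> (join_partition \<mu> P (\<Phi> n)) / real (card (\<Phi> n))) \<longlonglongrightarrow> h)"

definition ks_entropy :: "('g::group_add \<Rightarrow> 'a) measure \<Rightarrow> ereal"
  where "ks_entropy \<mu> = (SUP P \<in> {P. finite_partition \<mu> P}. ereal (partition_entropy_rate \<mu> P))"

definition max_entropy_measure ::
    "('g::group_add \<Rightarrow> 'a::discrete_topology) set \<Rightarrow> ('g \<Rightarrow> 'a) measure \<Rightarrow> bool"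
  where "max_entropy_measure X \<mu> \<longleftrightarrow>
    invariant_measure X \<mu> \<and> (\<forall>\<nu>. invariant_measure X \<nu> \<longrightarrow> ks_entropy \<nu> \<le> ks_entropy \<mu>)"

end

theory Submission
  imports Defs
begin

text \<open>
  Suppose \<open>\<mu>[v] > \<mu>[w]\<close>. Let \<open>x\<close> have law \<open>\<mu>\<close>, choose each site of \<open>G\<close> independently with
  probability \<open>\<epsilon>\<close>, and replace \<open>v\<close> by \<open>w\<close> at every chosen occurrence of \<open>v\<close> for which no
  overlapping translate of \<open>F\<close> is chosen. Since \<open>E\<^sub>X(v) \<subseteq> E\<^sub>X(w)\<close> and \<open>X\<close> is closed, the result \<open>y\<close>
  lies in \<open>X\<close>, and its law \<open>\<nu>\<close> is invariant. If \<open>R\<close> is the set of replaced sites, then \<open>(x, R)\<close> and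
  \<open>(y, R)\<close> determine each other, so per site \<open>h(\<nu>) = h(\<mu>) + h(R | x) - h(R | y)\<close>. Up to \<open>o(\<epsilon>)\<close>, the
  first term is at least \<open>\<mu>[v] (\<epsilon> ln (1/\<epsilon>) + \<epsilon>)\<close>. As the replaced sites carry \<open>w\<close> in \<open>y\<close>, the
  second is at most \<open>\<epsilon> \<mu>[v] (1 + ln (\<mu>[w] / (\<epsilon> \<mu>[v])))\<close> (with \<open>\<mu>[w] + O(\<epsilon>)\<close> in place of \<open>\<mu>[w]\<close>).
  The net gain is \<open>\<epsilon> \<mu>[v] ln (\<mu>[v] / \<mu>[w]) + o(\<epsilon>) > 0\<close>, contradicting maximality.

  Entropy rates are computed from finite windows: strong subadditivity and Shearer's inequality give
  the limit along every Foelner sequence, and the Kolmogorov--Sinai theorem reduces the supremum over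
  partitions to the partition by the symbol at \<open>0\<close>.
\<close>

section \<open>Entropy of simple functions\<close>

text \<open>Exchanging the two patterns at all occurrences is not an option: occurrences may
  overlap, and writing \<open>w\<close> may create or destroy occurrences of both patterns, so such
  an exchange is in general neither well defined nor reversible. Isolated sites cure the first
  defect, and keeping \<open>R\<close> cures the second. The price is a gain of order \<epsilon>
  only, while both conditional entropies have size \<epsilon> ln (1/\<epsilon>). These leading terms
  cancel, so every other error has to be o(\<epsilon>). There are two. Isolation makes the
  \<open>R g\<close> dependent; they are compared with \<open>U g\<close>, whose sites are
  independent given \<open>x\<close>. The two differ with probability O(\<epsilon>^2), and the bound
  4 p^(3/4) for \<open>eta p\<close> turns this into entropy O(\<epsilon>^(3/2)). Moreover
  \<open>w\<close> may be more frequent in \<open>y\<close> than in \<open>x\<close>, by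
  O(\<epsilon>); this is absorbed by a number strictly between the two measures, also when
  \<open>w\<close> has measure 0.\<close>

definition eta :: "real \<Rightarrow> real"
  where "eta t = - (t * ln t)"

text \<open>Random variables take the place of partitions, so that a join is a tuple. The value is
  meaningful for simple functions: over an infinite range the sum is 0.\<close>

definition ent :: "'x measure \<Rightarrow> ('x \<Rightarrow> 'b) \<Rightarrow> real"
  where "ent M f = (\<Sum>a\<in>f ` space M. eta (measure M {x \<in> space M. f x = a}))"

lemma eta_0 [simp]: "eta 0 = 0"
  by (simp add: eta_def)

lemma eta_1 [simp]: "eta 1 = 0"
  by (simp add: eta_def)

text \<open>The tangent of \<open>ln\<close> at 1, applied to 1/t. It bounds \<open>eta\<close> by
  1, and near 1 by the distance to 1.\<close>

lemma eta_le_1_minus: assumes "0 \<le> t" shows "eta t \<le> 1 - t"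
proof (cases "t = 0")
  case False
  then have "t > 0" using assms by simp
  have "ln (1/t) \<le> 1/t - 1" using \<open>t > 0\<close> by (intro ln_le_minus_one) auto
  then have "t * (- ln t) \<le> t * (1/t - 1)"
    using \<open>t > 0\<close> by (intro mult_left_mono) (auto simp: ln_div)
  also have "\<dots> = 1 - t" using \<open>t > 0\<close> by (simp add: right_diff_distrib)
  finally show ?thesis by (simp add: eta_def)
qed simp

text \<open>Merging atoms lowers entropy: \<open>ln\<close> is increasing, so each
  \<open>ln (p i)\<close> is at most the logarithm of the total.\<close>

lemma eta_sum_le:
  assumes "finite I" "\<And>i. i \<in> I \<Longrightarrow> 0 \<le> p i"
  shows "eta (\<Sum>i\<in>I. p i) \<le> (\<Sum>i\<in>I. eta (p i))"
proof -
  have "p i * ln (p i) \<le> p i * ln (\<Sum>i\<in>I. p i)" if "i \<in> I" for i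
  proof (cases "p i = 0")
    case False
    then have "p i > 0" using assms that by force
    moreover have "p i \<le> (\<Sum>i\<in>I. p i)" using assms that by (intro member_le_sum) auto
    ultimately show ?thesis by (intro mult_left_mono) auto
  qed simp
  then have "(\<Sum>i\<in>I. p i * ln (p i)) \<le> (\<Sum>i\<in>I. p i) * ln (\<Sum>i\<in>I. p i)"
    unfolding sum_distrib_right by (rule sum_mono)
  then show ?thesis by (simp add: eta_def sum_negf)
qed

text \<open>Subadditivity for weights of arbitrary total mass \<open>P\<close>; the term
  \<open>eta P\<close> makes up for the missing normalisation. This is the form that a single slice
  \<open>h = c\<close> of a joint distribution requires.\<close>

lemma eta_sum_subadditive:
  assumes fin: "finite A" "finite B" and p: "\<And>a b. a \<in> A \<Longrightarrow> b \<in> B \<Longrightarrow> 0 \<le> p a b"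
  defines "P \<equiv> (\<Sum>a\<in>A. \<Sum>b\<in>B. p a b)"
  shows "(\<Sum>a\<in>A. \<Sum>b\<in>B. eta (p a b)) + eta P
    \<le> (\<Sum>a\<in>A. eta (\<Sum>b\<in>B. p a b)) + (\<Sum>b\<in>B. eta (\<Sum>a\<in>A. p a b))"
proof -
  define q where "q a = (\<Sum>b\<in>B. p a b)" for a
  define r where "r b = (\<Sum>a\<in>A. p a b)" for b
  have Pq: "P = (\<Sum>a\<in>A. q a)" by (simp add: P_def q_def)
  have Pr: "P = (\<Sum>b\<in>B. r b)" unfolding P_def r_def by (rule sum.swap)
  have q0: "q a \<ge> 0" if "a \<in> A" for a using that p by (auto simp: q_def intro: sum_nonneg)
  have r0: "r b \<ge> 0" if "b \<in> B" for b using that p by (auto simp: r_def intro: sum_nonneg)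
  have P0: "P \<ge> 0" unfolding Pq using q0 by (auto intro: sum_nonneg)
  \<comment> \<open>Gibbs' inequality, term by term, against the product weights
    \<open>q a * r b / P\<close>, which have the same total \<open>P\<close>.\<close>
  have pt: "p a b * (ln (q a) + ln (r b) - ln P - ln (p a b)) \<le> q a * r b / P - p a b"
    if ab: "a \<in> A" "b \<in> B" for a b
  proof (cases "p a b = 0")
    case True
    then show ?thesis using q0 r0 P0 ab by simp
  next
    case False
    then have p1: "p a b > 0" using p ab by force
    have "p a b \<le> q a" unfolding q_def using ab fin p by (intro member_le_sum) auto
    moreover have "p a b \<le> r b" unfolding r_def using ab fin p by (intro member_le_sum[of a A "\<lambda>a. p a b"]) auto
    moreover have "q a \<le> P" unfolding Pq using ab fin q0 by (intro member_le_sum) auto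
    ultimately have pos: "q a > 0" "r b > 0" "P > 0" using p1 by linarith+
    have "ln (q a * r b / (P * p a b)) \<le> q a * r b / (P * p a b) - 1"
      using pos p1 by (intro ln_le_minus_one) auto
    then have "p a b * (ln (q a * r b / (P * p a b))) \<le> p a b * (q a * r b / (P * p a b) - 1)"
      using p1 by (intro mult_left_mono) auto
    also have "ln (q a * r b / (P * p a b)) = ln (q a) + ln (r b) - ln P - ln (p a b)"
      using pos p1 by (simp add: ln_div ln_mult)
    also have "p a b * (q a * r b / (P * p a b) - 1) = q a * r b / P - p a b"
      using pos p1 by (simp add: field_simps)
    finally show ?thesis .
  qed
  have e1: "(\<Sum>a\<in>A. \<Sum>b\<in>B. p a b * ln (q a)) = - (\<Sum>a\<in>A. eta (q a))"
    by (simp add: eta_def q_def sum_negf sum_distrib_right)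
  have e2: "(\<Sum>a\<in>A. \<Sum>b\<in>B. p a b * ln (r b)) = - (\<Sum>b\<in>B. eta (r b))"
    by (subst sum.swap) (simp add: eta_def r_def sum_negf sum_distrib_right)
  have e3: "(\<Sum>a\<in>A. \<Sum>b\<in>B. p a b * ln P) = - eta P"
    by (simp add: eta_def P_def sum_distrib_right)
  have e4: "(\<Sum>a\<in>A. \<Sum>b\<in>B. p a b * ln (p a b)) = - (\<Sum>a\<in>A. \<Sum>b\<in>B. eta (p a b))"
    by (simp add: eta_def sum_negf)
  have e5: "(\<Sum>a\<in>A. \<Sum>b\<in>B. q a * r b / P) = P"
  proof -
    have "(\<Sum>a\<in>A. \<Sum>b\<in>B. q a * r b / P) = (\<Sum>a\<in>A. q a) * (\<Sum>b\<in>B. r b) / P"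
      by (simp add: sum_product sum_divide_distrib)
    then show ?thesis by (simp add: Pq[symmetric] Pr[symmetric])
  qed
  have "(\<Sum>a\<in>A. \<Sum>b\<in>B. p a b * (ln (q a) + ln (r b) - ln P - ln (p a b)))
      \<le> (\<Sum>a\<in>A. \<Sum>b\<in>B. q a * r b / P - p a b)"
    by (intro sum_mono pt)
  also have "\<dots> = 0"
    by (simp add: sum_subtractf e5) (simp add: P_def)
  finally have "- (\<Sum>a\<in>A. eta (q a)) - (\<Sum>b\<in>B. eta (r b)) + eta P
      + (\<Sum>a\<in>A. \<Sum>b\<in>B. eta (p a b)) \<le> 0"
    by (simp add: distrib_left right_diff_distrib sum.distrib sum_subtractf e1 e2 e3 e4)
  then show ?thesis by (simp add: q_def r_def)
qed

lemma simple_function_level: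
  assumes "simple_function M f"
  shows "{x \<in> space M. f x = a} \<in> sets M"
proof -
  have "{x \<in> space M. f x = a} = f -` {a} \<inter> space M" by auto
  then show ?thesis using simple_functionD(2)[OF assms] by simp
qed

lemma simple_function_restrict:
  assumes "finite S" "\<And>i. i \<in> S \<Longrightarrow> simple_function M (Z i)"
  shows "simple_function M (\<lambda>x. restrict (\<lambda>i. Z i x) S)"
  using assms
proof (induction S)
  case empty
  have e: "(\<lambda>x. restrict (\<lambda>i. Z i x) {}) = (\<lambda>_ _. undefined)"
    by (simp add: fun_eq_iff)
  show ?case unfolding e by (rule simple_function_const)
next
  case (insert s S)
  have "simple_function M (\<lambda>x. (\<lambda>(a, r). r(s := a)) (Z s x, restrict (\<lambda>i. Z i x) S))"
    by (rule simple_function_compose1, rule simple_function_Pair)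
      (use insert in blast)+
  moreover have "(\<lambda>x. (\<lambda>(a, r). r(s := a)) (Z s x, restrict (\<lambda>i. Z i x) S))
      = (\<lambda>x. restrict (\<lambda>i. Z i x) (insert s S))"
    by (auto simp: fun_eq_iff restrict_def)
  ultimately show ?case by (simp only:)
qed

lemma simple_function_restrict_fun:
  assumes "finite S" "\<And>g. simple_function M (\<lambda>x. f x g)"
  shows "simple_function M (\<lambda>x. restrict (f x) S)"
  using simple_function_restrict[OF assms(1), of M "\<lambda>g x. f x g"] assms(2) by simp

text \<open>Values that are not attained have empty level sets and contribute \<open>eta 0\<close>.
  This permits product index sets in place of the exact range of a tuple.\<close>

lemma ent_superset:
  assumes "finite S" "f ` space M \<subseteq> S"
  shows "ent M f = (\<Sum>a\<in>S. eta (measure M {x \<in> space M. f x = a}))"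
  unfolding ent_def
proof (rule sum.mono_neutral_left[OF assms], rule ballI)
  fix a assume "a \<in> S - f ` space M"
  then have e: "{x \<in> space M. f x = a} = {}" by auto
  show "eta (measure M {x \<in> space M. f x = a}) = 0" unfolding e by simp
qed

context finite_measure
begin

lemma measure_level_sum:
  assumes f: "simple_function M f" and E: "E \<in> sets M" and S: "finite S" "f ` E \<subseteq> S"
  shows "measure M E = (\<Sum>a\<in>S. measure M {x \<in> E. f x = a})"
proof -
  have EE: "{x \<in> E. f x = a} = E \<inter> {x \<in> space M. f x = a}" for a
    using sets.sets_into_space[OF E] by auto
  have "E = (\<Union>a\<in>S. {x \<in> E. f x = a})" using S by auto
  then have "measure M E = measure M (\<Union>a\<in>S. {x \<in> E. f x = a})" by simp
  also have "\<dots> = (\<Sum>a\<in>S. measure M {x \<in> E. f x = a})"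
    using S E by (intro finite_measure_finite_Union)
      (auto simp: disjoint_family_on_def EE simple_function_level[OF f])
  finally show ?thesis .
qed

text \<open>By \<open>det\<close>, \<open>f\<close> is a function of \<open>g\<close>; its level
  sets are unions of level sets of \<open>g\<close>, and merging lowers entropy.\<close>

lemma ent_mono:
  assumes g: "simple_function M g"
    and det: "\<And>x y. x \<in> space M \<Longrightarrow> y \<in> space M \<Longrightarrow> g x = g y \<Longrightarrow> f x = f y"
  shows "ent M f \<le> ent M g"
proof -
  define \<phi> where "\<phi> b = f (inv_into (space M) g b)" for b
  have \<phi>: "f x = \<phi> (g x)" if "x \<in> space M" for x
    unfolding \<phi>_def using that
    by (intro det) (auto intro: inv_into_into f_inv_into_f[symmetric])
  have fin: "finite (g ` space M)" using g by (rule simple_functionD)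
  have im: "f ` space M = \<phi> ` (g ` space M)" using \<phi> by (auto simp: image_image)
  have sub: "eta (measure M {x \<in> space M. f x = c})
      \<le> (\<Sum>b | b \<in> g ` space M \<and> \<phi> b = c. eta (measure M {x \<in> space M. g x = b}))" for c
  proof -
    have sf: "simple_function M (\<lambda>x. \<phi> (g x))" using g by (rule simple_function_compose1)
    have "{x \<in> space M. f x = c} = {x \<in> space M. \<phi> (g x) = c}" using \<phi> by auto
    then have "measure M {x \<in> space M. f x = c} = measure M {x \<in> space M. \<phi> (g x) = c}" by simp
    also have "\<dots> = (\<Sum>b | b \<in> g ` space M \<and> \<phi> b = c.
        measure M {x \<in> {x \<in> space M. \<phi> (g x) = c}. g x = b})"
      using fin by (intro measure_level_sum[OF g] simple_function_level[OF sf]) auto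
    also have "\<dots> = (\<Sum>b | b \<in> g ` space M \<and> \<phi> b = c. measure M {x \<in> space M. g x = b})"
      by (intro sum.cong arg_cong[where f="measure M"]) auto
    finally show ?thesis using fin by (simp only:) (intro eta_sum_le; simp)
  qed
  have "ent M f = (\<Sum>c\<in>\<phi> ` (g ` space M). eta (measure M {x \<in> space M. f x = c}))"
    unfolding ent_def im ..
  also have "\<dots> \<le> (\<Sum>c\<in>\<phi> ` (g ` space M).
      \<Sum>b | b \<in> g ` space M \<and> \<phi> b = c. eta (measure M {x \<in> space M. g x = b}))"
    by (intro sum_mono sub)
  also have "\<dots> = ent M g"
    unfolding ent_def by (rule sum.image_gen[symmetric, OF fin])
  finally show ?thesis .
qed

lemma ent_eqI:
  assumes "simple_function M f" "simple_function M g"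
    and "\<And>x y. x \<in> space M \<Longrightarrow> y \<in> space M \<Longrightarrow> f x = f y \<longleftrightarrow> g x = g y"
  shows "ent M f = ent M g"
  using assms by (intro antisym ent_mono) auto

text \<open>Fix the value of \<open>h\<close>: each slice is an instance of
  \<open>eta_sum_subadditive\<close>, in which \<open>eta P\<close> becomes a term of
  \<open>ent M h\<close>.\<close>

lemma ent_strong_subadditive:
  assumes f: "simple_function M f" and g: "simple_function M g" and h: "simple_function M h"
  shows "ent M (\<lambda>x. (f x, g x, h x)) + ent M h \<le> ent M (\<lambda>x. (f x, h x)) + ent M (\<lambda>x. (g x, h x))"
proof -
  let ?A = "f ` space M" and ?B = "g ` space M" and ?C = "h ` space M"
  let ?p = "\<lambda>a b c. measure M {x \<in> space M. f x = a \<and> g x = b \<and> h x = c}"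
  have fin: "finite ?A" "finite ?B" "finite ?C" using f g h by (auto dest: simple_functionD)
  have s1: "{x \<in> space M. f x = a \<and> h x = c} \<in> sets M" for a c
    using simple_function_level[OF simple_function_Pair[OF f h], of "(a, c)"] by simp
  have s2: "{x \<in> space M. g x = b \<and> h x = c} \<in> sets M" for b c
    using simple_function_level[OF simple_function_Pair[OF g h], of "(b, c)"] by simp
  have m1: "measure M {x \<in> space M. f x = a \<and> h x = c} = (\<Sum>b\<in>?B. ?p a b c)" for a c
    by (subst measure_level_sum[OF g s1 fin(2)])
      (auto intro!: sum.cong arg_cong[where f="measure M"])
  have m2: "measure M {x \<in> space M. g x = b \<and> h x = c} = (\<Sum>a\<in>?A. ?p a b c)" for b c
    by (subst measure_level_sum[OF f s2 fin(1)])
      (auto intro!: sum.cong arg_cong[where f="measure M"])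
  have m3: "measure M {x \<in> space M. h x = c} = (\<Sum>a\<in>?A. \<Sum>b\<in>?B. ?p a b c)" for c
    unfolding m1[symmetric]
    by (subst measure_level_sum[OF f simple_function_level[OF h] fin(1)])
      (auto intro!: sum.cong arg_cong[where f="measure M"])
  have e1: "ent M (\<lambda>x. (f x, g x, h x)) = (\<Sum>c\<in>?C. \<Sum>a\<in>?A. \<Sum>b\<in>?B. eta (?p a b c))"
  proof -
    have "ent M (\<lambda>x. (f x, g x, h x)) = (\<Sum>z\<in>?A \<times> ?B \<times> ?C. eta (measure M {x \<in> space M. (f x, g x, h x) = z}))"
      using fin by (intro ent_superset) auto
    also have "\<dots> = (\<Sum>a\<in>?A. \<Sum>b\<in>?B. \<Sum>c\<in>?C. eta (?p a b c))"
      by (simp add: sum.cartesian_product split_def) (simp add: prod_eq_iff)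
    also have "\<dots> = (\<Sum>a\<in>?A. \<Sum>c\<in>?C. \<Sum>b\<in>?B. eta (?p a b c))"
      by (intro sum.cong refl, rule sum.swap)
    also have "\<dots> = (\<Sum>c\<in>?C. \<Sum>a\<in>?A. \<Sum>b\<in>?B. eta (?p a b c))" by (rule sum.swap)
    finally show ?thesis .
  qed
  have pr: "ent M (\<lambda>x. (k x, h x)) = (\<Sum>c\<in>?C. \<Sum>a\<in>k ` space M. eta (measure M {x \<in> space M. k x = a \<and> h x = c}))"
    if "finite (k ` space M)" for k :: "'a \<Rightarrow> 'z"
  proof -
    have "ent M (\<lambda>x. (k x, h x)) = (\<Sum>z\<in>k ` space M \<times> ?C. eta (measure M {x \<in> space M. (k x, h x) = z}))"
      using fin that by (intro ent_superset) auto
    also have "\<dots> = (\<Sum>a\<in>k ` space M. \<Sum>c\<in>?C. eta (measure M {x \<in> space M. k x = a \<and> h x = c}))"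
      by (simp add: sum.cartesian_product split_def) (simp add: prod_eq_iff)
    also have "\<dots> = (\<Sum>c\<in>?C. \<Sum>a\<in>k ` space M. eta (measure M {x \<in> space M. k x = a \<and> h x = c}))"
      by (rule sum.swap)
    finally show ?thesis .
  qed
  show ?thesis
    unfolding e1 pr[OF fin(1)] pr[OF fin(2)] ent_def[of M h] sum.distrib[symmetric] m1 m2 m3
    using fin by (intro sum_mono eta_sum_subadditive) auto
qed

end

section \<open>Conditional entropy and families of random variables\<close>

text \<open>The chain rule taken as definition, which turns every statement on conditional entropy
  into one on \<open>ent\<close> of tuples.\<close>

definition cond_ent :: "'x measure \<Rightarrow> ('x \<Rightarrow> 'b) \<Rightarrow> ('x \<Rightarrow> 'c) \<Rightarrow> real"
  where "cond_ent M f g = ent M (\<lambda>x. (f x, g x)) - ent M g"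

definition joint_ent :: "'x measure \<Rightarrow> ('i \<Rightarrow> 'x \<Rightarrow> 'b) \<Rightarrow> 'i set \<Rightarrow> real"
  where "joint_ent M Z S = ent M (\<lambda>x. restrict (\<lambda>i. Z i x) S)"

lemma restrict_eq_restrict_iff: "restrict f S = restrict g S \<longleftrightarrow> (\<forall>i\<in>S. f i = g i)"
  by (auto simp: restrict_def fun_eq_iff)

context finite_measure
begin

text \<open>Strong subadditivity; as \<open>h\<close> is a function of \<open>g\<close>, adjoining
  \<open>h\<close> to a tuple that contains \<open>g\<close> does not change its entropy.\<close>

lemma cond_ent_mono_cond:
  assumes f: "simple_function M f" and g: "simple_function M g" and h: "simple_function M h"
    and det: "\<And>x y. x \<in> space M \<Longrightarrow> y \<in> space M \<Longrightarrow> g x = g y \<Longrightarrow> h x = h y"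
  shows "cond_ent M f g \<le> cond_ent M f h"
proof -
  have "ent M (\<lambda>x. (f x, g x, h x)) = ent M (\<lambda>x. (f x, g x))"
    by (intro ent_eqI simple_function_Pair f g h) (auto intro: det)
  moreover have "ent M (\<lambda>x. (g x, h x)) = ent M g"
    by (intro ent_eqI simple_function_Pair f g h) (auto intro: det)
  ultimately show ?thesis
    using ent_strong_subadditive[OF f g h] by (simp add: cond_ent_def)
qed

lemma cond_ent_mono:
  assumes "simple_function M f'" "simple_function M g"
    and det: "\<And>x y. x \<in> space M \<Longrightarrow> y \<in> space M \<Longrightarrow> f' x = f' y \<Longrightarrow> g x = g y \<Longrightarrow> f x = f y"
  shows "cond_ent M f g \<le> cond_ent M f' g"
  unfolding cond_ent_def using assms(1,2)
  by (intro diff_right_mono ent_mono simple_function_Pair) (auto intro: det)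

lemma cond_ent_chain:
  assumes f: "simple_function M f" and g: "simple_function M g" and h: "simple_function M h"
  shows "cond_ent M (\<lambda>x. (f x, g x)) h = cond_ent M g h + cond_ent M f (\<lambda>x. (g x, h x))"
proof -
  have "ent M (\<lambda>x. ((f x, g x), h x)) = ent M (\<lambda>x. (f x, g x, h x))"
    by (intro ent_eqI simple_function_Pair f g h) auto
  then show ?thesis by (simp add: cond_ent_def)
qed

lemma cond_ent_eqI:
  assumes "simple_function M f" "simple_function M f'" "simple_function M g"
    and "\<And>x y. x \<in> space M \<Longrightarrow> y \<in> space M \<Longrightarrow> g x = g y \<Longrightarrow> f' x = f' y \<longleftrightarrow> f x = f y"
  shows "cond_ent M f g = cond_ent M f' g"
  using assms by (intro antisym cond_ent_mono) blast+

lemma cond_ent_restrict_insert: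
  assumes Z: "\<And>i. i \<in> insert s S \<Longrightarrow> simple_function M (Z i)" and fin: "finite S"
    and g: "simple_function M g"
  shows "cond_ent M (\<lambda>x. restrict (\<lambda>i. Z i x) (insert s S)) g
    = cond_ent M (\<lambda>x. restrict (\<lambda>i. Z i x) S) g + cond_ent M (Z s) (\<lambda>x. (restrict (\<lambda>i. Z i x) S, g x))"
proof -
  have sS: "simple_function M (\<lambda>x. restrict (\<lambda>i. Z i x) S)"
    using Z fin by (intro simple_function_restrict) auto
  have ss: "simple_function M (\<lambda>x. restrict (\<lambda>i. Z i x) (insert s S))"
    using Z fin by (intro simple_function_restrict) auto
  have "cond_ent M (\<lambda>x. restrict (\<lambda>i. Z i x) (insert s S)) g
      = cond_ent M (\<lambda>x. (Z s x, restrict (\<lambda>i. Z i x) S)) g"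
    using Z by (intro cond_ent_eqI simple_function_Pair ss sS g) (auto simp: restrict_eq_restrict_iff)
  also have "\<dots> = cond_ent M (\<lambda>x. restrict (\<lambda>i. Z i x) S) g
      + cond_ent M (Z s) (\<lambda>x. (restrict (\<lambda>i. Z i x) S, g x))"
    using Z by (intro cond_ent_chain sS g) auto
  finally show ?thesis .
qed

lemma cond_ent_empty [simp]:
  assumes g: "simple_function M g"
  shows "cond_ent M (\<lambda>x. restrict (\<lambda>i. Z i x) {}) g = 0"
proof -
  have "ent M (\<lambda>x. (restrict (\<lambda>i. Z i x) {}, g x)) = ent M g"
    using simple_function_restrict[of "{}" M Z]
    by (intro ent_eqI simple_function_Pair g) (auto simp: restrict_eq_restrict_iff)
  then show ?thesis by (simp add: cond_ent_def)
qed

lemma cond_ent_restrict_le_sum: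
  assumes "finite S" "\<And>i. i \<in> S \<Longrightarrow> simple_function M (Z i)" and g: "simple_function M g"
  shows "cond_ent M (\<lambda>x. restrict (\<lambda>i. Z i x) S) g \<le> (\<Sum>i\<in>S. cond_ent M (Z i) g)"
  using assms(1,2)
proof (induction S)
  case empty
  show ?case by (simp only: cond_ent_empty[OF g]) simp
next
  case (insert s S)
  have "cond_ent M (Z s) (\<lambda>x. (restrict (\<lambda>i. Z i x) S, g x)) \<le> cond_ent M (Z s) g"
    using insert by (intro cond_ent_mono_cond simple_function_Pair simple_function_restrict g) auto
  moreover have "cond_ent M (\<lambda>x. restrict (\<lambda>i. Z i x) S) g \<le> (\<Sum>i\<in>S. cond_ent M (Z i) g)"
    using insert by blast
  moreover have e: "cond_ent M (\<lambda>x. restrict (\<lambda>i. Z i x) (insert s S)) g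
    = cond_ent M (\<lambda>x. restrict (\<lambda>i. Z i x) S) g + cond_ent M (Z s) (\<lambda>x. (restrict (\<lambda>i. Z i x) S, g x))"
    using insert g by (intro cond_ent_restrict_insert) auto
  ultimately show ?case unfolding e sum.insert[OF insert.hyps] by linarith
qed

text \<open>Reveal the coordinates one by one. Each is conditioned on those revealed before, which
  is less than all the others, so it still contributes at least \<open>c\<close>.\<close>

lemma cond_ent_restrict_ge:
  assumes "finite S" "\<And>i. i \<in> S \<Longrightarrow> simple_function M (Z i)" and g: "simple_function M g"
    and c: "\<And>i. i \<in> S \<Longrightarrow> c \<le> cond_ent M (Z i) (\<lambda>x. (restrict (\<lambda>i. Z i x) (S - {i}), g x))"
  shows "real (card S) * c \<le> cond_ent M (\<lambda>x. restrict (\<lambda>i. Z i x) S) g"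
proof -
  \<comment> \<open>The induction runs over \<open>T\<close> inside the fixed \<open>S\<close>,
    since the hypothesis on \<open>c\<close> conditions on all of \<open>S - {i}\<close>.\<close>
  have "T \<subseteq> S \<Longrightarrow> real (card T) * c \<le> cond_ent M (\<lambda>x. restrict (\<lambda>i. Z i x) T) g" if "finite T" for T
    using that
  proof (induction T)
    case empty
    show ?case by (simp only: cond_ent_empty[OF g]) simp
  next
    case (insert s T)
    have "c \<le> cond_ent M (Z s) (\<lambda>x. (restrict (\<lambda>i. Z i x) (S - {s}), g x))"
      using insert c by blast
    also have "\<dots> \<le> cond_ent M (Z s) (\<lambda>x. (restrict (\<lambda>i. Z i x) T, g x))"
      using insert assms(1,2)
      by (intro cond_ent_mono_cond simple_function_Pair simple_function_restrict g)
        (auto simp: restrict_eq_restrict_iff)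
    finally have 1: "c \<le> cond_ent M (Z s) (\<lambda>x. (restrict (\<lambda>i. Z i x) T, g x))" .
    have 2: "cond_ent M (\<lambda>x. restrict (\<lambda>i. Z i x) (insert s T)) g
      = cond_ent M (\<lambda>x. restrict (\<lambda>i. Z i x) T) g + cond_ent M (Z s) (\<lambda>x. (restrict (\<lambda>i. Z i x) T, g x))"
      using insert g assms by (intro cond_ent_restrict_insert) auto
    have 3: "real (card T) * c \<le> cond_ent M (\<lambda>x. restrict (\<lambda>i. Z i x) T) g"
      using insert by blast
    have "real (card (insert s T)) * c = c + real (card T) * c"
      using insert.hyps by (simp add: distrib_right)
    then show ?case unfolding 2 using 1 3 by linarith
  qed
  then show ?thesis using assms(1) by blast
qed

text \<open>Strong subadditivity with the variables on \<open>S \<inter> T\<close> as the common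
  part. This makes Shearer's inequality applicable to \<open>joint_ent\<close>.\<close>

lemma joint_ent_submodular:
  assumes Z: "\<And>i. simple_function M (Z i)" and fin: "finite S" "finite T"
  shows "joint_ent M Z (S \<union> T) + joint_ent M Z (S \<inter> T) \<le> joint_ent M Z S + joint_ent M Z T"
proof -
  let ?r = "\<lambda>S x. restrict (\<lambda>i. Z i x) S"
  have s: "simple_function M (?r A)" if "finite A" for A
    using that Z by (intro simple_function_restrict)
  have "ent M (\<lambda>x. (?r S x, ?r T x, ?r (S \<inter> T) x)) = joint_ent M Z (S \<union> T)"
    unfolding joint_ent_def using fin
    by (intro ent_eqI simple_function_Pair s) (auto simp: restrict_eq_restrict_iff)
  moreover have "ent M (\<lambda>x. (?r S x, ?r (S \<inter> T) x)) = joint_ent M Z S"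
    unfolding joint_ent_def using fin
    by (intro ent_eqI simple_function_Pair s) (auto simp: restrict_eq_restrict_iff)
  moreover have "ent M (\<lambda>x. (?r T x, ?r (S \<inter> T) x)) = joint_ent M Z T"
    unfolding joint_ent_def using fin
    by (intro ent_eqI simple_function_Pair s) (auto simp: restrict_eq_restrict_iff)
  ultimately show ?thesis
    using ent_strong_subadditive[of "?r S" "?r T" "?r (S \<inter> T)"] s fin by (simp add: joint_ent_def)
qed

lemma joint_ent_mono:
  assumes Z: "\<And>i. simple_function M (Z i)" and fin: "finite T" and "S \<subseteq> T"
  shows "joint_ent M Z S \<le> joint_ent M Z T"
  unfolding joint_ent_def using assms
  by (intro ent_mono simple_function_restrict) (auto simp: restrict_eq_restrict_iff)

end

context prob_space
begin

text \<open>Weaken the condition to a constant variable, whose entropy is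
  \<open>eta 1 = 0\<close>.\<close>

lemma cond_ent_le_ent:
  assumes f: "simple_function M f" and g: "simple_function M g"
  shows "cond_ent M f g \<le> ent M f"
proof -
  have h: "simple_function M (\<lambda>_. ())" by simp
  have "cond_ent M f g \<le> cond_ent M f (\<lambda>_. ())" by (intro cond_ent_mono_cond f g h) simp
  also have "\<dots> \<le> ent M (\<lambda>x. (f x, ()))"
    by (simp add: cond_ent_def ent_def not_empty prob_space)
  also have "\<dots> = ent M f" by (intro ent_eqI simple_function_Pair f h) simp
  finally show ?thesis .
qed

text \<open>A crude substitute for the logarithm of the cardinality. It is only spent on sites near
  the boundary of a window.\<close>

lemma ent_le_card:
  assumes "simple_function M f" "finite S" "f ` space M \<subseteq> S"
  shows "ent M f \<le> real (card S)"
proof -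
  have "ent M f \<le> (\<Sum>a\<in>S. 1)"
    unfolding ent_superset[OF assms(2,3)]
  proof (rule sum_mono)
    fix a
    show "eta (measure M {x \<in> space M. f x = a}) \<le> 1"
      using eta_le_1_minus[OF measure_nonneg, of M "{x \<in> space M. f x = a}"]
        measure_nonneg[of M "{x \<in> space M. f x = a}"] by linarith
  qed
  then show ?thesis by simp
qed

lemma ent_pred:
  assumes "simple_function M P"
  shows "ent M P = eta (prob {x \<in> space M. P x}) + eta (1 - prob {x \<in> space M. P x})"
proof -
  have "ent M P = (\<Sum>a\<in>{True, False}. eta (prob {x \<in> space M. P x = a}))"
    by (intro ent_superset) auto
  also have "\<dots> = eta (prob {x \<in> space M. P x}) + eta (prob {x \<in> space M. \<not> P x})" by simp
  also have "prob {x \<in> space M. \<not> P x} = 1 - prob {x \<in> space M. P x}"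
    using simple_function_level[OF assms, of True] by (intro prob_neg) simp
  finally show ?thesis .
qed

lemma joint_ent_empty: "joint_ent M Z {} = 0"
proof -
  have "(\<lambda>x. restrict (\<lambda>i. Z i x) {}) ` space M \<subseteq> {\<lambda>_. undefined}" by auto
  then have "joint_ent M Z {} = (\<Sum>a\<in>{\<lambda>_. undefined}. eta (prob {x \<in> space M. restrict (\<lambda>i. Z i x) {} = a}))"
    unfolding joint_ent_def by (intro ent_superset) auto
  also have "\<dots> = eta (prob {x \<in> space M. restrict (\<lambda>i. Z i x) {} = (\<lambda>_. undefined)})"
    by (subst sum.insert) (simp_all only: finite.emptyI empty_iff not_False_eq_True sum.empty add_0_right)
  also have "{x \<in> space M. restrict (\<lambda>i. Z i x) {} = (\<lambda>_. undefined)} = space M"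
    by (simp add: restrict_def)
  finally show ?thesis by (simp add: prob_space)
qed

end

section \<open>Shearer's inequality and limits along Foelner sequences\<close>

text \<open>Points of \<open>S\<close> are added one at a time. By submodularity a new point
  \<open>s\<close> raises \<open>H\<close> on every \<open>A j\<close> that contains it at least as
  much as on all of \<open>S\<close>, and at least \<open>k\<close> of the \<open>A j\<close>
  contain it.\<close>

lemma shearer:
  fixes H :: "'i set \<Rightarrow> real"
  assumes mono: "\<And>S T. finite T \<Longrightarrow> S \<subseteq> T \<Longrightarrow> H S \<le> H T"
    and submod: "\<And>S T. finite S \<Longrightarrow> finite T \<Longrightarrow> H (S \<union> T) + H (S \<inter> T) \<le> H S + H T"
    and empty: "H {} = 0" and J: "finite J"
  shows "finite S \<Longrightarrow> (\<And>s. s \<in> S \<Longrightarrow> k \<le> card {j \<in> J. s \<in> A j}) \<Longrightarrow>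
    real k * H S \<le> (\<Sum>j\<in>J. H (A j \<inter> S))"
proof (induction S rule: finite_induct)
  case empty
  then show ?case using \<open>H {} = 0\<close> by simp
next
  case (insert s S)
  let ?d = "H (insert s S) - H S"
  \<comment> \<open>The sign matters because \<open>s\<close> may lie in more than \<open>k\<close>
    of the sets.\<close>
  have d0: "?d \<ge> 0" using mono[of "insert s S" S] insert.hyps by auto
  have st: "H (A j \<inter> S) + (if s \<in> A j then ?d else 0) \<le> H (A j \<inter> insert s S)" for j
  proof (cases "s \<in> A j")
    case True
    have "H ((A j \<inter> insert s S) \<union> S) + H ((A j \<inter> insert s S) \<inter> S) \<le> H (A j \<inter> insert s S) + H S"
      using insert.hyps by (intro submod) auto
    moreover have "(A j \<inter> insert s S) \<union> S = insert s S" using True by auto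
    moreover have "(A j \<inter> insert s S) \<inter> S = A j \<inter> S" by auto
    ultimately show ?thesis using True by simp
  qed simp
  have "real k * H (insert s S) = real k * H S + real k * ?d" by (simp add: algebra_simps)
  also have "\<dots> \<le> (\<Sum>j\<in>J. H (A j \<inter> S)) + real (card {j \<in> J. s \<in> A j}) * ?d"
    using insert d0 by (intro add_mono mult_right_mono) auto
  also have "real (card {j \<in> J. s \<in> A j}) * ?d = (\<Sum>j\<in>J. if s \<in> A j then ?d else 0)"
    using J by (simp add: sum.If_cases Int_def)
  also have "(\<Sum>j\<in>J. H (A j \<inter> S)) + \<dots> \<le> (\<Sum>j\<in>J. H (A j \<inter> insert s S))"
    unfolding sum.distrib[symmetric] by (intro sum_mono st)
  finally show ?case .
qed

text \<open>The product set of \<open>S\<close> and \<open>K\<close>. The factor \<open>K\<close>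
  acts from the right, the side on which Foelner sequences are almost invariant.\<close>

definition translates :: "'g::group_add set \<Rightarrow> 'g set \<Rightarrow> 'g set"
  where "translates S K = (\<Union>k\<in>K. (\<lambda>h. h + k) ` S)"

lemma finite_translates: "finite S \<Longrightarrow> finite K \<Longrightarrow> finite (translates S K)"
  by (simp add: translates_def)

lemma folner_sequence_boundary:
  assumes \<Phi>: "folner_sequence \<Phi>"
  shows "(\<lambda>n. real (card ((\<lambda>h. h + k) ` \<Phi> n - \<Phi> n)) / real (card (\<Phi> n))) \<longlonglongrightarrow> 0"
proof (rule tendsto_sandwich[OF _ _ tendsto_const])
  show "(\<lambda>n. real (card (sym_diff ((\<lambda>h. h + k) ` \<Phi> n) (\<Phi> n))) / real (card (\<Phi> n))) \<longlonglongrightarrow> 0"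
    using \<Phi> by (auto simp: folner_sequence_def)
  have "finite (\<Phi> n)" for n using \<Phi> by (auto simp: folner_sequence_def)
  then show "\<forall>\<^sub>F n in sequentially. real (card ((\<lambda>h. h + k) ` \<Phi> n - \<Phi> n)) / real (card (\<Phi> n))
      \<le> real (card (sym_diff ((\<lambda>h. h + k) ` \<Phi> n) (\<Phi> n))) / real (card (\<Phi> n))"
    by (intro always_eventually allI divide_right_mono of_nat_mono card_mono) auto
qed auto

text \<open>Errors at the edge of a window are counted by such sets; a union bound over the finite
  set \<open>K\<close> shows that they are negligible.\<close>

lemma folner_sequence_translates_diff:
  assumes \<Phi>: "folner_sequence \<Phi>" and K: "finite K"
  shows "(\<lambda>n. real (card (translates (\<Phi> n) K - \<Phi> n)) / real (card (\<Phi> n))) \<longlonglongrightarrow> 0"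
proof (rule tendsto_sandwich[OF _ _ tendsto_const])
  have "(\<lambda>n. \<Sum>k\<in>K. real (card ((\<lambda>h. h + k) ` \<Phi> n - \<Phi> n)) / real (card (\<Phi> n))) \<longlonglongrightarrow> (\<Sum>k\<in>K. 0)"
    by (intro tendsto_sum folner_sequence_boundary \<Phi>)
  then show "(\<lambda>n. \<Sum>k\<in>K. real (card ((\<lambda>h. h + k) ` \<Phi> n - \<Phi> n)) / real (card (\<Phi> n))) \<longlonglongrightarrow> 0"
    by simp
  have "real (card (translates (\<Phi> n) K - \<Phi> n)) / real (card (\<Phi> n))
      \<le> (\<Sum>k\<in>K. real (card ((\<lambda>h. h + k) ` \<Phi> n - \<Phi> n)) / real (card (\<Phi> n)))" for n
  proof -
    have "translates (\<Phi> n) K - \<Phi> n = (\<Union>k\<in>K. (\<lambda>h. h + k) ` \<Phi> n - \<Phi> n)"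
      by (auto simp: translates_def)
    then have "card (translates (\<Phi> n) K - \<Phi> n) \<le> (\<Sum>k\<in>K. card ((\<lambda>h. h + k) ` \<Phi> n - \<Phi> n))"
      using K by (simp only: card_UN_le)
    then have "real (card (translates (\<Phi> n) K - \<Phi> n)) \<le> (\<Sum>k\<in>K. real (card ((\<lambda>h. h + k) ` \<Phi> n - \<Phi> n)))"
      unfolding of_nat_sum[symmetric] of_nat_le_iff .
    then show ?thesis unfolding sum_divide_distrib[symmetric] by (rule divide_right_mono) simp
  qed
  then show "\<forall>\<^sub>F n in sequentially. real (card (translates (\<Phi> n) K - \<Phi> n)) / real (card (\<Phi> n))
      \<le> (\<Sum>k\<in>K. real (card ((\<lambda>h. h + k) ` \<Phi> n - \<Phi> n)) / real (card (\<Phi> n)))"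
    by (intro always_eventually allI)
qed auto

text \<open>The limit is an infimum that does not mention \<Phi>, and it bounds every term from
  below. For the upper bound, cover \<open>\<Phi> n\<close> by left translates of \<open>S\<close>:
  each point is covered \<open>card S\<close> times, and Shearer's inequality compares
  \<open>H (\<Phi> n)\<close> with the number of translates.\<close>

lemma folner_sequence_subadditive_limit:
  fixes H :: "'g::group_add set \<Rightarrow> real"
  assumes \<Phi>: "folner_sequence \<Phi>"
    and mono: "\<And>S T. finite T \<Longrightarrow> S \<subseteq> T \<Longrightarrow> H S \<le> H T"
    and submod: "\<And>S T. finite S \<Longrightarrow> finite T \<Longrightarrow> H (S \<union> T) + H (S \<inter> T) \<le> H S + H T"
    and empty: "H {} = 0" and inv: "\<And>g S. finite S \<Longrightarrow> H ((+) g ` S) = H S"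
  shows "(\<lambda>n. H (\<Phi> n) / real (card (\<Phi> n)))
    \<longlonglongrightarrow> (INF S\<in>{S. finite S \<and> S \<noteq> {}}. H S / real (card S))"
proof -
  define I where "I = (INF S\<in>{S. finite S \<and> S \<noteq> {}}. H S / real (card S))"
  have fin: "finite (\<Phi> n)" "\<Phi> n \<noteq> {}" for n using \<Phi> by (auto simp: folner_sequence_def)
  have c0: "card (\<Phi> n) > 0" for n using fin by (simp add: card_gt_0_iff)
  have H0: "H S \<ge> 0" if "finite S" for S using mono[OF that, of "{}"] empty by simp
  have bdd: "bdd_below ((\<lambda>S. H S / real (card S)) ` {S. finite S \<and> S \<noteq> {}})"
    by (rule bdd_belowI[of _ 0]) (auto intro!: divide_nonneg_nonneg H0)
  have low: "I \<le> H (\<Phi> n) / real (card (\<Phi> n))" for n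
    unfolding I_def using fin by (intro cINF_lower bdd) auto
  have up: "H (\<Phi> n) / real (card (\<Phi> n)) \<le>
      (1 + real (card (translates (\<Phi> n) (uminus ` S) - \<Phi> n)) / real (card (\<Phi> n))) * (H S / real (card S))"
    if S: "finite S" "S \<noteq> {}" for S n
  proof -
    \<comment> \<open>The base points \<open>j\<close> of the left translates of \<open>S\<close>
      that meet \<open>\<Phi> n\<close>.\<close>
    define J where "J = translates (\<Phi> n) (uminus ` S)"
    have finJ: "finite J" unfolding J_def using fin S by (intro finite_translates) auto
    have "real (card S) * H (\<Phi> n) \<le> (\<Sum>j\<in>J. H ((+) j ` S \<inter> \<Phi> n))"
    proof (rule shearer[OF mono submod empty finJ fin(1)])
      fix s assume s: "s \<in> \<Phi> n"
      \<comment> \<open>\<open>s\<close> lies in the translate at \<open>s - f\<close> for each of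
        the \<open>card S\<close> elements \<open>f\<close> of \<open>S\<close>.\<close>
      have "(\<lambda>f. s - f) ` S \<subseteq> {j \<in> J. s \<in> (+) j ` S}"
      proof safe
        fix f assume f: "f \<in> S"
        have "s - f = s + (- f)" by simp
        then show "s - f \<in> J" unfolding J_def translates_def using s f by blast
        show "s \<in> (+) (s - f) ` S" using f by (intro image_eqI[of _ _ f]) auto
      qed
      then have "card ((\<lambda>f. s - f) ` S) \<le> card {j \<in> J. s \<in> (+) j ` S}"
        using finJ by (intro card_mono) auto
      moreover have "inj_on (\<lambda>f. s - f) S"
        by (rule inj_onI) (metis add_left_cancel diff_conv_add_uminus neg_equal_iff_equal)
      ultimately show "card S \<le> card {j \<in> J. s \<in> (+) j ` S}" by (simp add: card_image)
    qed
    also have "\<dots> \<le> (\<Sum>j\<in>J. H S)"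
      using S fin by (intro sum_mono order.trans[OF mono eq_refl[OF inv]]) auto
    finally have 1: "real (card S) * H (\<Phi> n) \<le> real (card J) * H S" by simp
    \<comment> \<open>By the Foelner condition \<open>J\<close> is hardly larger than
      \<open>\<Phi> n\<close>.\<close>
    have "card J \<le> card (\<Phi> n \<union> (J - \<Phi> n))" using fin finJ by (intro card_mono) auto
    also have "\<dots> \<le> card (\<Phi> n) + card (J - \<Phi> n)" by (rule card_Un_le)
    finally have "real (card J) * H S \<le> (real (card (\<Phi> n)) + real (card (J - \<Phi> n))) * H S"
      using H0 S by (intro mult_right_mono) auto
    with 1 have 2: "real (card S) * H (\<Phi> n) \<le> (real (card (\<Phi> n)) + real (card (J - \<Phi> n))) * H S"
      by linarith
    have cS: "card S > 0" using S by (simp add: card_gt_0_iff)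
    have "H (\<Phi> n) / real (card (\<Phi> n)) = (real (card S) * H (\<Phi> n)) / (real (card S) * real (card (\<Phi> n)))"
      using cS by simp
    also have "\<dots> \<le> ((real (card (\<Phi> n)) + real (card (J - \<Phi> n))) * H S) / (real (card S) * real (card (\<Phi> n)))"
      using 2 by (rule divide_right_mono) simp
    also have "\<dots> = (1 + real (card (J - \<Phi> n)) / real (card (\<Phi> n))) * (H S / real (card S))"
      using cS c0[of n] by (simp add: field_simps)
    finally show ?thesis unfolding J_def .
  qed
  have "(\<lambda>n. H (\<Phi> n) / real (card (\<Phi> n))) \<longlonglongrightarrow> I"
  proof (rule order_tendstoI)
    fix a assume "a < I"
    then show "\<forall>\<^sub>F n in sequentially. a < H (\<Phi> n) / real (card (\<Phi> n))"
      using low by (intro always_eventually allI) (rule less_le_trans)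
  next
    fix a assume "I < a"
    then obtain S where S: "finite S" "S \<noteq> {}" "H S / real (card S) < a"
      unfolding I_def using cINF_less_iff[OF _ bdd, of a] by auto
    have "(\<lambda>n. (1 + real (card (translates (\<Phi> n) (uminus ` S) - \<Phi> n)) / real (card (\<Phi> n))) * (H S / real (card S)))
       \<longlonglongrightarrow> (1 + 0) * (H S / real (card S))"
      using S by (intro tendsto_intros folner_sequence_translates_diff \<Phi>) auto
    then have "\<forall>\<^sub>F n in sequentially. (1 + real (card (translates (\<Phi> n) (uminus ` S) - \<Phi> n)) / real (card (\<Phi> n))) * (H S / real (card S)) < a"
      using S by (intro order_tendstoD) auto
    then show "\<forall>\<^sub>F n in sequentially. H (\<Phi> n) / real (card (\<Phi> n)) < a"
      by (rule eventually_mono) (rule le_less_trans[OF up[OF S(1,2)]])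
  qed
  then show ?thesis unfolding I_def .
qed

section \<open>Approximation by cylinder sets\<close>

lemma open_fun_finite_support:
  fixes U :: "('g \<Rightarrow> 'a::topological_space) set"
  assumes "open U" "y \<in> U"
  obtains K where "finite K" "\<And>z. \<forall>i\<in>K. z i = y i \<Longrightarrow> z \<in> U"
proof -
  obtain X where X: "y \<in> (\<Pi>\<^sub>E i\<in>UNIV. X i)" "finite {i. X i \<noteq> UNIV}" "(\<Pi>\<^sub>E i\<in>UNIV. X i) \<subseteq> U"
    using product_topology_open_contains_basis[of "\<lambda>_. euclidean" UNIV U y] assms
    unfolding open_fun_def by auto
  show ?thesis
  proof (rule that[OF X(2)])
    fix z assume z: "\<forall>i\<in>{i. X i \<noteq> UNIV}. z i = y i"
    have "z i \<in> X i" for i using z X(1) by (cases "X i = UNIV") (auto simp: PiE_iff)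
    then show "z \<in> U" using X(3) by (auto simp: PiE_iff)
  qed
qed

text \<open>A point outside a closed set has a finite window that keeps every agreeing point
  outside. This carries the replacement from finitely many sites to infinitely many.\<close>

lemma closed_fun_memI:
  fixes X :: "('g \<Rightarrow> 'a::topological_space) set"
  assumes "closed X" and ex: "\<And>K. finite K \<Longrightarrow> \<exists>z\<in>X. \<forall>i\<in>K. z i = y i"
  shows "y \<in> X"
proof (rule ccontr)
  assume "y \<notin> X"
  then obtain K where "finite K" "\<And>z. \<forall>i\<in>K. z i = y i \<Longrightarrow> z \<in> - X"
    using open_fun_finite_support[of "- X" y] \<open>closed X\<close> by (auto simp: open_Compl)
  then show False using ex by blast
qed

text \<open>The group is countable and the alphabet finite, so there are only countably many finite
  windows and finitely many patterns on each.\<close>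

lemma open_fun_countable_Union:
  fixes U :: "('g::countable \<Rightarrow> 'a::{finite, topological_space}) set"
  assumes "open U"
  obtains I :: "('g set \<times> ('g \<Rightarrow> 'a)) set" where "countable I" "fst ` I \<subseteq> {K. finite K}"
    "U = (\<Union>(K, r)\<in>I. {z. restrict z K = r})"
proof -
  let ?I0 = "SIGMA K:{K :: 'g set. finite K}. (K \<rightarrow>\<^sub>E (UNIV :: 'a set))"
  define I where "I = {(K, r) \<in> ?I0. {z. restrict z K = r} \<subseteq> U}"
  have "countable ?I0"
    by (intro countable_SIGMA) (auto intro: countable_Collect_finite countable_finite[OF finite_PiE])
  then have c: "countable I" by (rule countable_subset[rotated]) (auto simp: I_def)
  have "U = (\<Union>(K, r)\<in>I. {z. restrict z K = r})"
  proof (intro equalityI subsetI)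
    fix y assume y: "y \<in> U"
    obtain K where K: "finite K" "\<And>z. \<forall>i\<in>K. z i = y i \<Longrightarrow> z \<in> U"
      using open_fun_finite_support[OF assms y] by blast
    then have "(K, restrict y K) \<in> I" by (auto simp: I_def restrict_eq_restrict_iff)
    then show "y \<in> (\<Union>(K, r)\<in>I. {z. restrict z K = r})" by auto
  qed (auto simp: I_def)
  moreover have "fst ` I \<subseteq> {K. finite K}" by (auto simp: I_def)
  ultimately show ?thesis using that[OF c] by blast
qed

lemma sets_Collect_restrict_eq:
  fixes f :: "'x \<Rightarrow> 'g \<Rightarrow> 'a"
  assumes "\<And>i a. {\<omega> \<in> space N. f \<omega> i = a} \<in> sets N" "finite K"
  shows "{\<omega> \<in> space N. restrict (f \<omega>) K = r} \<in> sets N"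
proof (cases "r \<in> extensional K")
  case True
  then have "{\<omega> \<in> space N. restrict (f \<omega>) K = r} = {\<omega> \<in> space N. \<forall>i\<in>K. f \<omega> i = r i}"
    by (auto simp: extensional_def restrict_def fun_eq_iff)
  also have "\<dots> \<in> sets N" using assms by (intro sets.sets_Collect_finite_All) auto
  finally show ?thesis .
next
  case False
  then have "{\<omega> \<in> space N. restrict (f \<omega>) K = r} = {}" by auto
  then show ?thesis by (simp only: sets.empty_sets)
qed

text \<open>Open sets are countable unions of cylinders, so it suffices to check single
  coordinates.\<close>

lemma measurable_fun_borelI:
  fixes f :: "'x \<Rightarrow> 'g::countable \<Rightarrow> 'a::{finite, topological_space}"
  assumes f: "\<And>i a. {\<omega> \<in> space N. f \<omega> i = a} \<in> sets N"
  shows "f \<in> borel_measurable N"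
proof (rule borel_measurableI)
  fix U :: "('g \<Rightarrow> 'a) set" assume "open U"
  then obtain I :: "('g set \<times> ('g \<Rightarrow> 'a)) set" where I: "countable I" "fst ` I \<subseteq> {K. finite K}"
    and U: "U = (\<Union>(K, r)\<in>I. {z. restrict z K = r})" by (rule open_fun_countable_Union)
  have "f -` U \<inter> space N = (\<Union>(K, r)\<in>I. {\<omega> \<in> space N. restrict (f \<omega>) K = r})"
    unfolding U by auto
  also have "\<dots> \<in> sets N"
    using I by (intro sets.countable_UN'') (auto intro!: sets_Collect_restrict_eq f)
  finally show "f -` U \<inter> space N \<in> sets N" .
qed

lemma borel_coordinate_level:
  fixes i :: 'g and a :: "'a::discrete_topology"
  shows "{x. x i = a} \<in> sets (borel :: ('g \<Rightarrow> 'a) measure)"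
proof -
  have "open ((\<lambda>x. x i) -` {a} :: ('g \<Rightarrow> 'a) set)"
    by (intro open_vimage) (auto simp: discrete_topology_class.open_discrete)
  moreover have "(\<lambda>x. x i) -` {a} = {x :: 'g \<Rightarrow> 'a. x i = a}" by auto
  ultimately show ?thesis by (metis borel_open)
qed

lemma coordinate_level:
  fixes X :: "('g \<Rightarrow> 'a::discrete_topology) set"
  assumes "sets M = sets (restrict_space borel X)"
  shows "{x \<in> space M. x i = a} \<in> sets M"
proof -
  have "space M = X" using sets_eq_imp_space_eq[OF assms] by (simp add: space_restrict_space)
  then have "{x \<in> space M. x i = a} = X \<inter> {x. x i = a}" by auto
  also have "\<dots> \<in> sets M" unfolding assms sets_restrict_space by (intro imageI borel_coordinate_level)
  finally show ?thesis .
qed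

lemma simple_function_coordinate:
  fixes X :: "('g \<Rightarrow> 'a::{finite, discrete_topology}) set"
  assumes "sets M = sets (restrict_space borel X)"
  shows "simple_function M (\<lambda>x. x i)"
proof -
  have "(\<lambda>x. x i) -` {a} \<inter> space M = {x \<in> space M. x i = a}" for a by auto
  then show ?thesis by (simp add: simple_function_def coordinate_level[OF assms])
qed

definition local_sets :: "('g \<Rightarrow> 'a) measure \<Rightarrow> 'g set \<Rightarrow> ('g \<Rightarrow> 'a) set set"
  where "local_sets M K = {{x \<in> space M. restrict x K \<in> Q} | Q. True}"

text \<open>Approximation in measure by events seen in a finite window. The sets with this property
  form a sigma-algebra that contains the open sets of \<open>X\<close>, hence all measurable
  sets.\<close>

definition locally_approximable :: "('g \<Rightarrow> 'a) measure \<Rightarrow> ('g \<Rightarrow> 'a) set \<Rightarrow> bool"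
  where "locally_approximable M A \<longleftrightarrow> A \<in> sets M \<and>
    (\<forall>\<delta>>0. \<exists>K. finite K \<and> (\<exists>C\<in>local_sets M K. measure M (sym_diff A C) < \<delta>))"

text \<open>In this form, without \<open>Q\<close>, closure under complements and finite unions can
  be read off.\<close>

lemma local_sets_iff:
  "C \<in> local_sets M K \<longleftrightarrow> C \<subseteq> space M \<and>
    (\<forall>x\<in>space M. \<forall>y\<in>space M. restrict x K = restrict y K \<longrightarrow> (x \<in> C \<longleftrightarrow> y \<in> C))"
proof
  assume C: "C \<subseteq> space M \<and>
    (\<forall>x\<in>space M. \<forall>y\<in>space M. restrict x K = restrict y K \<longrightarrow> (x \<in> C \<longleftrightarrow> y \<in> C))"
  then have "C = {x \<in> space M. restrict x K \<in> (\<lambda>x. restrict x K) ` C}" by blast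
  then show "C \<in> local_sets M K" unfolding local_sets_def by blast
qed (auto simp: local_sets_def)

lemma sets_local_set:
  fixes X :: "('g \<Rightarrow> 'a::{finite, discrete_topology}) set"
  assumes M: "sets M = sets (restrict_space borel X)" and "finite K" "C \<in> local_sets M K"
  shows "C \<in> sets M"
proof -
  obtain Q where C: "C = {x \<in> space M. restrict x K \<in> Q}" using assms(3) by (auto simp: local_sets_def)
  have "simple_function M (\<lambda>x. restrict x K)"
    using simple_function_restrict[of K M "\<lambda>i x. x i"] simple_function_coordinate[OF M] assms(2)
    by simp
  from simple_functionD(2)[OF this, of Q] have "(\<lambda>x. restrict x K) -` Q \<inter> space M \<in> sets M" .
  moreover have "(\<lambda>x. restrict x K) -` Q \<inter> space M = C" by (auto simp: C)
  ultimately show ?thesis by simp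
qed

lemma locally_approximable_local_set:
  fixes X :: "('g \<Rightarrow> 'a::{finite, discrete_topology}) set"
  assumes M: "sets M = sets (restrict_space borel X)" and "finite K" "C \<in> local_sets M K"
  shows "locally_approximable M C"
  unfolding locally_approximable_def
  using assms sets_local_set[OF assms] by (auto intro!: exI[of _ K] bexI[of _ C])

lemma locally_approximable_Compl:
  assumes A: "locally_approximable M A"
  shows "locally_approximable M (space M - A)"
  unfolding locally_approximable_def
proof (intro conjI allI impI)
  show "space M - A \<in> sets M" using A by (auto simp: locally_approximable_def)
next
  fix \<delta> :: real assume "\<delta> > 0"
  with A obtain K C where KC: "finite K" "C \<in> local_sets M K" "measure M (sym_diff A C) < \<delta>"
    by (auto simp: locally_approximable_def)
  have "A \<subseteq> space M" using A sets.sets_into_space by (auto simp: locally_approximable_def)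
  moreover have "C \<subseteq> space M" using KC(2) by (auto simp: local_sets_iff)
  ultimately have "sym_diff (space M - A) (space M - C) = sym_diff A C" by auto
  moreover have "space M - C \<in> local_sets M K" using KC(2) unfolding local_sets_iff by blast
  ultimately show "\<exists>K. finite K \<and> (\<exists>C\<in>local_sets M K. measure M (sym_diff (space M - A) C) < \<delta>)"
    using KC by (intro exI[of _ K] conjI bexI[of _ "space M - C"]) auto
qed

text \<open>Cut the union off at a finite stage, losing less than \<open>\<delta> / 2\<close>, and
  spend the other half on the remaining sets.\<close>

lemma locally_approximable_Union:
  fixes X :: "('g \<Rightarrow> 'a::{finite, discrete_topology}) set" and A :: "nat \<Rightarrow> ('g \<Rightarrow> 'a) set"
  assumes M: "sets M = sets (restrict_space borel X)" "finite_measure M"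
    and A: "\<And>n. locally_approximable M (A n)"
  shows "locally_approximable M (\<Union>n. A n)"
  unfolding locally_approximable_def
proof (intro conjI allI impI)
  interpret finite_measure M by fact
  have As: "A n \<in> sets M" for n using A by (auto simp: locally_approximable_def)
  then show Us: "(\<Union>n. A n) \<in> sets M" by auto
  fix \<delta> :: real assume d: "\<delta> > 0"
  have "(\<lambda>n. measure M (\<Union>i<n. A i)) \<longlonglongrightarrow> measure M (\<Union>n. \<Union>i<n. A i)"
    using As by (intro finite_Lim_measure_incseq monoI UN_mono) auto
  moreover have "(\<Union>n. \<Union>i<n. A i) = (\<Union>n. A n)" by auto
  ultimately have "(\<lambda>n. measure M (\<Union>i<n. A i)) \<longlonglongrightarrow> measure M (\<Union>n. A n)" by simp
  then have "\<forall>\<^sub>F n in sequentially. measure M (\<Union>n. A n) - \<delta> / 2 < measure M (\<Union>i<n. A i)"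
    using d by (intro order_tendstoD) auto
  then obtain n where n: "measure M (\<Union>n. A n) - \<delta> / 2 < measure M (\<Union>i<n. A i)"
    by (auto simp: eventually_sequentially)
  \<comment> \<open>The first \<open>n\<close> errors add up to at most \<open>\<delta> / 2\<close>;
    the \<open>+ 1\<close> keeps the quotient meaningful for \<open>n = 0\<close>.\<close>
  have "\<forall>i. \<exists>K. finite K \<and> (\<exists>C\<in>local_sets M K. measure M (sym_diff (A i) C) < \<delta> / (2 * (real n + 1)))"
    using A d by (auto simp: locally_approximable_def)
  then obtain K C where KC: "\<And>i. finite (K i)" "\<And>i. C i \<in> local_sets M (K i)"
    "\<And>i. measure M (sym_diff (A i) (C i)) < \<delta> / (2 * (real n + 1))" by metis
  have Cs: "C i \<in> sets M" for i using sets_local_set[OF M(1) KC(1) KC(2)] .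
  have "(\<Union>i<n. C i) \<in> local_sets M (\<Union>i<n. K i)"
    unfolding local_sets_iff
  proof (intro conjI ballI impI)
    show "(\<Union>i<n. C i) \<subseteq> space M" using KC(2) by (auto simp: local_sets_iff)
    fix x y assume xy: "x \<in> space M" "y \<in> space M" "restrict x (\<Union>i<n. K i) = restrict y (\<Union>i<n. K i)"
    have "x \<in> C i \<longleftrightarrow> y \<in> C i" if "i < n" for i
    proof -
      have "restrict x (K i) = restrict y (K i)"
        using xy(3) that unfolding restrict_eq_restrict_iff by blast
      then show ?thesis using KC(2)[of i] xy(1,2) unfolding local_sets_iff by blast
    qed
    then show "x \<in> (\<Union>i<n. C i) \<longleftrightarrow> y \<in> (\<Union>i<n. C i)" by auto
  qed
  moreover have "measure M (sym_diff (\<Union>n. A n) (\<Union>i<n. C i)) < \<delta>"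
  proof -
    have "measure M (sym_diff (\<Union>n. A n) (\<Union>i<n. C i))
        \<le> measure M (((\<Union>n. A n) - (\<Union>i<n. A i)) \<union> (\<Union>i<n. sym_diff (A i) (C i)))"
      using As Cs by (intro finite_measure_mono) auto
    also have "\<dots> \<le> measure M ((\<Union>n. A n) - (\<Union>i<n. A i)) + measure M (\<Union>i<n. sym_diff (A i) (C i))"
      using As Cs by (intro measure_Un_le) auto
    also have "measure M ((\<Union>n. A n) - (\<Union>i<n. A i)) = measure M (\<Union>n. A n) - measure M (\<Union>i<n. A i)"
      using As by (intro finite_measure_Diff) auto
    also have "measure M (\<Union>i<n. sym_diff (A i) (C i)) \<le> (\<Sum>i<n. measure M (sym_diff (A i) (C i)))"
      using As Cs by (intro finite_measure_subadditive_finite) auto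
    also have "\<dots> \<le> (\<Sum>i<n. \<delta> / (2 * (real n + 1)))"
      by (intro sum_mono less_imp_le KC)
    also have "\<dots> = \<delta> / 2 * (real n / (real n + 1))" by simp
    also have "\<dots> \<le> \<delta> / 2 * 1"
      using d by (intro mult_left_mono) auto
    finally show ?thesis using n by simp
  qed
  ultimately show "\<exists>K. finite K \<and> (\<exists>Ca\<in>local_sets M K. measure M (sym_diff (\<Union>n. A n) Ca) < \<delta>)"
    using KC(1) by (intro exI[of _ "\<Union>i<n. K i"]) auto
qed

lemma locally_approximable_sets:
  fixes X :: "('g::countable \<Rightarrow> 'a::{finite, discrete_topology}) set"
  assumes M: "sets M = sets (restrict_space borel X)" "finite_measure M" and A: "A \<in> sets M"
  shows "locally_approximable M A"
proof -
  have sp: "space M = X" using sets_eq_imp_space_eq[OF M(1)] by (simp add: space_restrict_space)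
  obtain B where B: "B \<in> sets borel" "A = X \<inter> B"
    using A unfolding M(1) sets_restrict_space by auto
  have e: "locally_approximable M {}"
    using locally_approximable_local_set[OF M(1), of "{}" "{}"] by (auto simp: local_sets_iff)
  have "locally_approximable M (X \<inter> B)"
    using B(1) unfolding sets_borel
  proof (induction B rule: sigma_sets.induct)
    case (Basic U)
    then have "open U" by simp
    then obtain I :: "('g set \<times> ('g \<Rightarrow> 'a)) set" where I: "countable I" "fst ` I \<subseteq> {K. finite K}"
      and U: "U = (\<Union>(K, r)\<in>I. {z. restrict z K = r})" by (rule open_fun_countable_Union)
    \<comment> \<open>The enumeration by \<open>from_nat_into\<close> requires a nonempty index
      set.\<close>
    show ?case
    proof (cases "I = {}")
      case True
      then show ?thesis using U e by simp
    next
      case False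
      let ?C = "\<lambda>(K, r). {z \<in> X. restrict z K = r}"
      have "locally_approximable M (?C (from_nat_into I n))" for n
      proof -
        obtain K r where Kr: "from_nat_into I n = (K, r)" by force
        then have "(K, r) \<in> I" using from_nat_into[OF False, of n] by simp
        then have "finite K" using I by force
        then show ?thesis unfolding Kr using sp
          by (auto intro!: locally_approximable_local_set[OF M(1), of K] simp: local_sets_iff)
      qed
      then have "locally_approximable M (\<Union>n. ?C (from_nat_into I n))"
        by (rule locally_approximable_Union[OF M])
      also have "(\<Union>n. ?C (from_nat_into I n)) = (\<Union>i\<in>range (from_nat_into I). ?C i)" by simp
      also have "\<dots> = X \<inter> U" unfolding range_from_nat_into[OF False I(1)] U by auto
      finally show ?thesis .
    qed
  next
    case Empty
    then show ?case using e by simp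
  next
    case (Compl B)
    have "X \<inter> (UNIV - B) = space M - (X \<inter> B)" using sp by auto
    then show ?case using locally_approximable_Compl[OF Compl(2)] by simp
  next
    case (Union B)
    then show ?case using locally_approximable_Union[OF M, of "\<lambda>n. X \<inter> B n"] by simp
  qed
  then show ?thesis using B by simp
qed

section \<open>Entropy of shift-invariant measures\<close>

lemma ent_distr:
  assumes T: "T \<in> measurable M N" and f: "simple_function N f"
  shows "ent (distr M N T) f = ent M (\<lambda>x. f (T x))"
proof -
  have fin: "finite (f ` space N)" using f by (rule simple_functionD)
  have "ent (distr M N T) f = (\<Sum>a\<in>f ` space N. eta (measure (distr M N T) {x \<in> space N. f x = a}))"
    by (simp add: ent_def)
  also have "\<dots> = (\<Sum>a\<in>f ` space N. eta (measure M {x \<in> space M. f (T x) = a}))"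
  proof (intro sum.cong refl arg_cong[where f=eta])
    fix a
    have "T -` {x \<in> space N. f x = a} \<inter> space M = {x \<in> space M. f (T x) = a}"
      using measurable_space[OF T] by auto
    then show "measure (distr M N T) {x \<in> space N. f x = a} = measure M {x \<in> space M. f (T x) = a}"
      by (simp only: measure_distr[OF T simple_function_level[OF f]])
  qed
  also have "\<dots> = ent M (\<lambda>x. f (T x))"
    using measurable_space[OF T] by (intro ent_superset[OF fin, symmetric]) auto
  finally show ?thesis .
qed

lemma shift_shift: "shift g (shift k x) = shift (k + g) x"
  by (simp add: shift_def add.assoc)

text \<open>Write p = s^4; then \<open>eta p\<close> is \<open>4 * s ^ 3 * eta s\<close>, and
  \<open>eta s\<close> is at most 1. What matters is that the exponent 3/4 exceeds 1/2: for an event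
  of probability O(\<epsilon>^2) the bound is O(\<epsilon>^(3/2)), hence o(\<epsilon>).\<close>

lemma eta_le_root: assumes "0 \<le> p" shows "eta p \<le> 4 * sqrt (sqrt p) ^ 3"
proof (cases "p = 0")
  case False
  define s where "s = sqrt (sqrt p)"
  have s: "s > 0" using assms False by (simp add: s_def)
  have "(sqrt (sqrt p))\<^sup>2 = sqrt p" "(sqrt p)\<^sup>2 = p" using assms by auto
  then have p: "p = s ^ 4" unfolding s_def by (metis power_mult mult_2 numeral_Bit0)
  have "eta p = 4 * s ^ 3 * eta s"
    unfolding p eta_def ln_realpow by (simp add: eval_nat_numeral)
  also have "\<dots> \<le> 4 * s ^ 3 * 1"
    using s eta_le_1_minus[of s] by (intro mult_left_mono) auto
  finally show ?thesis by (simp add: s_def)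
qed simp

lemma simple_function_mem:
  assumes "A \<in> sets M"
  shows "simple_function M (\<lambda>x. x \<in> A)"
proof -
  have "(\<lambda>x. x \<in> A) -` {b} \<inter> space M = (if b then A else space M - A)" for b
    using sets.sets_into_space[OF assms] by auto
  then show ?thesis unfolding simple_function_def using assms by auto
qed

locale invariant_subshift =
  fixes X :: "('g::{group_add, countable} \<Rightarrow> 'a::{finite, discrete_topology}) set"
    and \<mu> :: "('g \<Rightarrow> 'a) measure"
  assumes subshift: "subshift X" and invariant: "invariant_measure X \<mu>"
begin

sublocale prob_space \<mu>
  using invariant by (simp add: invariant_measure_def)

lemma sets_eq: "sets \<mu> = sets (restrict_space borel X)"
  using invariant by (simp add: invariant_measure_def)

lemma space_eq: "space \<mu> = X"
  using sets_eq_imp_space_eq[OF sets_eq] by (simp add: space_restrict_space)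

lemma shift_in: "x \<in> X \<Longrightarrow> shift g x \<in> X"
  using subshift by (auto simp: subshift_def)

lemma measurable_into:
  assumes "\<And>\<omega>. \<omega> \<in> space N \<Longrightarrow> f \<omega> \<in> X" "\<And>i a. {\<omega> \<in> space N. f \<omega> i = a} \<in> sets N"
  shows "f \<in> measurable N \<mu>"
proof -
  have "f \<in> measurable N (restrict_space borel X)"
    using assms by (intro measurable_restrict_space2 measurable_fun_borelI) auto
  then show ?thesis by (simp only: measurable_cong_sets[OF refl sets_eq])
qed

lemma simple_coordinate [simp]: "simple_function \<mu> (\<lambda>x. x i)"
  by (rule simple_function_coordinate[OF sets_eq])

lemma measurable_shift: "shift g \<in> measurable \<mu> \<mu>"
  using simple_function_level[OF simple_coordinate]
  by (intro measurable_into) (auto simp: shift_in space_eq, simp add: shift_def)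

lemma simple_shift:
  assumes "simple_function \<mu> f"
  shows "simple_function \<mu> (\<lambda>x. f (shift g x))"
  by (rule simple_function_comp[OF measurable_shift assms])

lemma ent_shift:
  assumes "simple_function \<mu> f"
  shows "ent \<mu> (\<lambda>x. f (shift g x)) = ent \<mu> f"
proof -
  have "distr \<mu> \<mu> (shift g) = \<mu>" using invariant by (simp add: invariant_measure_def)
  then show ?thesis using ent_distr[OF measurable_shift assms, of g] by simp
qed

lemma measure_shift:
  assumes "A \<in> sets \<mu>"
  shows "measure \<mu> {x \<in> X. shift g x \<in> A} = measure \<mu> A"
proof -
  have "distr \<mu> \<mu> (shift g) = \<mu>" using invariant by (simp add: invariant_measure_def)
  then have "measure \<mu> A = measure (distr \<mu> \<mu> (shift g)) A" by simp
  also have "\<dots> = measure \<mu> (shift g -` A \<inter> space \<mu>)"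
    by (rule measure_distr[OF measurable_shift assms])
  also have "shift g -` A \<inter> space \<mu> = {x \<in> X. shift g x \<in> A}" by (auto simp: space_eq)
  finally show ?thesis by simp
qed

text \<open>Precomposition with \<open>shift g\<close> turns the site \<open>k\<close> into
  \<open>g + k\<close>, so invariance of \<mu> becomes invariance under left translation of the
  window.\<close>

lemma joint_ent_translate:
  assumes f: "simple_function \<mu> f" and S: "finite S"
  shows "joint_ent \<mu> (\<lambda>g x. f (shift g x)) ((+) g ` S) = joint_ent \<mu> (\<lambda>g x. f (shift g x)) S"
proof -
  let ?r = "\<lambda>S x. restrict (\<lambda>k. f (shift k x)) S"
  have s: "simple_function \<mu> (?r A)" if "finite A" for A
    using that by (intro simple_function_restrict simple_shift f)
  have "joint_ent \<mu> (\<lambda>g x. f (shift g x)) S = ent \<mu> (\<lambda>x. ?r S (shift g x))"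
    unfolding joint_ent_def by (rule ent_shift[OF s[OF S], symmetric])
  also have "\<dots> = ent \<mu> (?r ((+) g ` S))"
    using S by (intro ent_eqI simple_shift[OF s] s) (auto simp: restrict_eq_restrict_iff shift_shift)
  finally show ?thesis by (simp add: joint_ent_def)
qed

lemma joint_ent_shift_limit:
  assumes f: "simple_function \<mu> f" and \<Phi>: "folner_sequence \<Phi>"
  shows "(\<lambda>n. joint_ent \<mu> (\<lambda>g x. f (shift g x)) (\<Phi> n) / real (card (\<Phi> n)))
    \<longlonglongrightarrow> (INF S\<in>{S. finite S \<and> S \<noteq> {}}. joint_ent \<mu> (\<lambda>g x. f (shift g x)) S / real (card S))"
  by (intro folner_sequence_subadditive_limit[OF \<Phi>] joint_ent_mono joint_ent_submodular joint_ent_empty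
      joint_ent_translate simple_shift f)

section \<open>Partitions and the Kolmogorov-Sinai theorem\<close>

text \<open>A partition encoded as a random variable, namely the part that contains the
  point.\<close>

definition cell :: "('g \<Rightarrow> 'a) set set \<Rightarrow> ('g \<Rightarrow> 'a) \<Rightarrow> ('g \<Rightarrow> 'a) set"
  where "cell P x = (THE p. p \<in> P \<and> x \<in> p)"

lemma cell_eqI:
  assumes "finite_partition \<mu> P" "p \<in> P" "x \<in> p"
  shows "cell P x = p"
  using assms unfolding cell_def finite_partition_def partition_on_def disjoint_def
  by (intro the_equality) blast+

lemma cell_mem:
  assumes P: "finite_partition \<mu> P" and x: "x \<in> X"
  shows "cell P x \<in> P" "x \<in> cell P x"
proof -
  obtain p where "p \<in> P" "x \<in> p"
    using P x unfolding finite_partition_def partition_on_def space_eq by blast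
  with cell_eqI[OF P this] show "cell P x \<in> P" "x \<in> cell P x" by auto
qed

lemma simple_cell:
  assumes P: "finite_partition \<mu> P"
  shows "simple_function \<mu> (cell P)"
  unfolding simple_function_def
proof
  show "finite (cell P ` space \<mu>)"
    using P by (rule_tac finite_subset[of _ P]) (auto simp: finite_partition_def cell_mem[OF P] space_eq)
  show "\<forall>p\<in>cell P ` space \<mu>. cell P -` {p} \<inter> space \<mu> \<in> sets \<mu>"
  proof
    fix p assume "p \<in> cell P ` space \<mu>"
    then have p: "p \<in> P" using cell_mem[OF P] by (auto simp: space_eq)
    then have ps: "p \<in> sets \<mu>" using P by (auto simp: finite_partition_def)
    have "cell P -` {p} \<inter> space \<mu> = p"
      using cell_eqI[OF P p] cell_mem[OF P] sets.sets_into_space[OF ps] by (auto simp: space_eq)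
    then show "cell P -` {p} \<inter> space \<mu> \<in> sets \<mu>" using ps by simp
  qed
qed

text \<open>A join is a set of sets, while \<open>joint_ent\<close> sums over labels. Different
  labels can name the same set only if it is empty, and then they contribute
  \<open>eta 0\<close>.\<close>

lemma shannon_entropy_join_partition:
  assumes P: "finite_partition \<mu> P" and F: "finite F"
  shows "shannon_entropy \<mu> (join_partition \<mu> P F) = joint_ent \<mu> (\<lambda>g x. cell P (shift g x)) F"
proof -
  let ?h = "\<lambda>p. {x \<in> space \<mu>. \<forall>g\<in>F. shift g x \<in> p g}"
  have finP: "finite (F \<rightarrow>\<^sub>E P)" using P F by (intro finite_PiE) (auto simp: finite_partition_def)
  have lev: "{x \<in> space \<mu>. restrict (\<lambda>g. cell P (shift g x)) F = p} = ?h p" if p: "p \<in> F \<rightarrow>\<^sub>E P" for p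
  proof -
    have "restrict (\<lambda>g. cell P (shift g x)) F = p \<longleftrightarrow> (\<forall>g\<in>F. shift g x \<in> p g)" if x: "x \<in> X" for x
    proof
      assume "restrict (\<lambda>g. cell P (shift g x)) F = p"
      then have "\<forall>g\<in>F. p g = cell P (shift g x)" by auto
      then show "\<forall>g\<in>F. shift g x \<in> p g" using cell_mem(2)[OF P shift_in[OF x]] by auto
    next
      assume *: "\<forall>g\<in>F. shift g x \<in> p g"
      have "cell P (shift g x) = p g" if "g \<in> F" for g
        using * that p by (intro cell_eqI[OF P]) (auto simp: PiE_iff)
      then show "restrict (\<lambda>g. cell P (shift g x)) F = p"
        using p by (auto simp: PiE_iff extensional_def fun_eq_iff)
    qed
    then show ?thesis by (auto simp: space_eq)
  qed
  have "shannon_entropy \<mu> (join_partition \<mu> P F) = (\<Sum>A\<in>?h ` (F \<rightarrow>\<^sub>E P). eta (measure \<mu> A))"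
    by (simp add: shannon_entropy_def join_partition_def eta_def sum_negf)
  also have "\<dots> = (\<Sum>p\<in>F \<rightarrow>\<^sub>E P. eta (measure \<mu> (?h p)))"
  proof (subst sum.reindex_nontrivial[OF finP])
    fix p q assume pq: "p \<in> F \<rightarrow>\<^sub>E P" "q \<in> F \<rightarrow>\<^sub>E P" "p \<noteq> q" "?h p = ?h q"
    have "?h p = {}"
      using pq(3) unfolding pq(4)[symmetric] lev[OF pq(1), symmetric]
      using lev[OF pq(1)] lev[OF pq(2)] pq(4) by blast
    then show "eta (measure \<mu> (?h p)) = 0" by (simp only: measure_empty eta_0)
  qed (simp add: o_def)
  also have "\<dots> = (\<Sum>p\<in>F \<rightarrow>\<^sub>E P. eta (measure \<mu> {x \<in> space \<mu>. restrict (\<lambda>g. cell P (shift g x)) F = p}))"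
    by (intro sum.cong refl arg_cong[where f=eta] arg_cong[where f="measure \<mu>"] lev[symmetric])
  also have "\<dots> = joint_ent \<mu> (\<lambda>g x. cell P (shift g x)) F"
    unfolding joint_ent_def
    by (intro ent_superset[symmetric] finP) (auto simp: cell_mem[OF P] shift_in space_eq)
  finally show ?thesis .
qed

text \<open>The infimum of \<open>joint_ent_shift_limit\<close> meets the description in
  \<open>partition_entropy_rate\<close>, and it is the only such number because a Foelner sequence
  exists.\<close>

lemma partition_entropy_rate_limit:
  assumes P: "finite_partition \<mu> P" and \<Phi>: "folner_sequence \<Phi>"
  shows "(\<lambda>n. joint_ent \<mu> (\<lambda>g x. cell P (shift g x)) (\<Phi> n) / real (card (\<Phi> n))) \<longlonglongrightarrow> partition_entropy_rate \<mu> P"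
proof -
  let ?I = "INF S\<in>{S. finite S \<and> S \<noteq> {}}. joint_ent \<mu> (\<lambda>g x. cell P (shift g x)) S / real (card S)"
  have lim: "(\<lambda>n. shannon_entropy \<mu> (join_partition \<mu> P (\<Psi> n)) / real (card (\<Psi> n))) \<longlonglongrightarrow> ?I"
    if \<Psi>: "folner_sequence \<Psi>" for \<Psi>
  proof -
    have "finite (\<Psi> n)" for n using \<Psi> by (simp add: folner_sequence_def)
    then show ?thesis
      using joint_ent_shift_limit[OF simple_cell[OF P] \<Psi>] by (simp only: shannon_entropy_join_partition[OF P])
  qed
  have "partition_entropy_rate \<mu> P = ?I"
    unfolding partition_entropy_rate_def
    using lim \<Phi> LIMSEQ_unique by (intro the_equality) blast+
  then show ?thesis using joint_ent_shift_limit[OF simple_cell[OF P] \<Phi>] by simp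
qed

text \<open>The partition by the symbol at 0. Symbols that never occur there are dropped, as a
  partition has no empty part.\<close>

definition zero_partition :: "('g \<Rightarrow> 'a) set set"
  where "zero_partition = (\<lambda>a. {x \<in> X. x 0 = a}) ` UNIV - {{}}"

lemma finite_partition_zero: "finite_partition \<mu> zero_partition"
proof -
  have "{x \<in> X. x 0 = a} \<in> sets \<mu>" for a
    using simple_function_level[OF simple_coordinate] by (simp add: space_eq)
  then show ?thesis
    unfolding finite_partition_def zero_partition_def partition_on_def disjoint_def space_eq by auto
qed

lemma joint_ent_zero_partition:
  assumes "finite S"
  shows "joint_ent \<mu> (\<lambda>g x. cell zero_partition (shift g x)) S = joint_ent \<mu> (\<lambda>g x. x g) S"
proof -
  have c: "cell zero_partition x = {y \<in> X. y 0 = x 0}" if "x \<in> X" for x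
    using that by (intro cell_eqI[OF finite_partition_zero]) (auto simp: zero_partition_def)
  have "cell zero_partition (shift g x) = cell zero_partition (shift g y) \<longleftrightarrow> x g = y g"
    if "x \<in> X" "y \<in> X" for g x y
  proof -
    have "shift g x \<in> X" "shift g x 0 = x g" "shift g y 0 = y g"
      using that by (auto simp: shift_in) (simp_all add: shift_def)
    then have "cell zero_partition (shift g x) = {z \<in> X. z 0 = x g}"
      "cell zero_partition (shift g y) = {z \<in> X. z 0 = y g}" "shift g x \<in> {z \<in> X. z 0 = x g}"
      using that by (auto simp: c shift_in)
    moreover have "x g = y g" if "shift g x \<in> {z \<in> X. z 0 = y g}"
      using that \<open>shift g x 0 = x g\<close> by simp
    ultimately show ?thesis by metis
  qed
  then show ?thesis
    unfolding joint_ent_def using assms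
    by (intro ent_eqI simple_function_restrict simple_shift simple_cell finite_partition_zero)
      (auto simp: restrict_eq_restrict_iff space_eq)
qed

lemma zero_partition_limit:
  assumes \<Phi>: "folner_sequence \<Phi>"
  shows "(\<lambda>n. joint_ent \<mu> (\<lambda>g x. x g) (\<Phi> n) / real (card (\<Phi> n))) \<longlonglongrightarrow> partition_entropy_rate \<mu> zero_partition"
proof -
  have "finite (\<Phi> n)" for n using \<Phi> by (simp add: folner_sequence_def)
  then show ?thesis
    using partition_entropy_rate_limit[OF finite_partition_zero \<Phi>] by (simp only: joint_ent_zero_partition)
qed

text \<open>Finite windows almost determine \<open>P\<close>. Given a large window, membership in a
  part \<open>p\<close> is decided by membership in the error set of a local approximation of
  \<open>p\<close>, and an event of small probability has small entropy.\<close>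

lemma small_conditional_entropy:
  assumes P: "finite_partition \<mu> P" and d: "\<delta> > 0"
  obtains K where "finite K" "cond_ent \<mu> (cell P) (\<lambda>x. restrict x K) < \<delta>"
proof -
  have finP: "finite P" and Ps: "P \<subseteq> sets \<mu>" using P by (auto simp: finite_partition_def)
  have sK: "simple_function \<mu> (\<lambda>x. restrict x K)" if "finite K" for K
    using simple_function_restrict[OF that, of \<mu> "\<lambda>i x. x i"] simple_coordinate by simp
  \<comment> \<open>The share of each part; the \<open>+ 1\<close> makes the sum of the shares
    strictly smaller than \<delta>.\<close>
  define \<epsilon> where "\<epsilon> = \<delta> / (real (card P) + 1)"
  have e: "\<epsilon> > 0" using d by (simp add: \<epsilon>_def)
  have "((\<lambda>t. 4 * sqrt (sqrt t) ^ 3 + t) \<longlongrightarrow> 4 * sqrt (sqrt 0) ^ 3 + 0) (at_right 0)"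
    by (intro tendsto_intros)
  then have "\<forall>\<^sub>F t in at_right 0. 4 * sqrt (sqrt t) ^ 3 + t < \<epsilon>"
    using e by (intro order_tendstoD) auto
  then obtain b where b: "b > 0" "\<And>t. 0 < t \<Longrightarrow> t < b \<Longrightarrow> 4 * sqrt (sqrt t) ^ 3 + t < \<epsilon>"
    by (auto simp: eventually_at_right_field)
  have small: "eta t + eta (1 - t) < \<epsilon>" if "0 \<le> t" "t < b" "t \<le> 1" for t
  proof (cases "t = 0")
    case False
    then show ?thesis using b(2)[of t] that eta_le_root[of t] eta_le_1_minus[of "1 - t"] by simp
  qed (use e in simp)
  have "\<forall>p\<in>P. \<exists>K. finite K \<and> (\<exists>C\<in>local_sets \<mu> K. measure \<mu> (sym_diff p C) < b)"
    using locally_approximable_sets[OF sets_eq finite_measure_axioms] Ps b(1)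
    unfolding locally_approximable_def by blast
  then obtain K C where KC: "\<And>p. p \<in> P \<Longrightarrow> finite (K p)" "\<And>p. p \<in> P \<Longrightarrow> C p \<in> local_sets \<mu> (K p)"
    "\<And>p. p \<in> P \<Longrightarrow> measure \<mu> (sym_diff p (C p)) < b" by metis
  define L where "L = (\<Union>p\<in>P. K p)"
  have finL: "finite L" using finP KC by (auto simp: L_def)
  have sp: "simple_function \<mu> (\<lambda>x. x \<in> A)" if "A \<in> sets \<mu>" for A
    using that by (rule simple_function_mem)
  have one: "cond_ent \<mu> (\<lambda>x. x \<in> p) (\<lambda>x. restrict x L) \<le> \<epsilon>" if p: "p \<in> P" for p
  proof -
    have ps: "p \<in> sets \<mu>" using p Ps by auto
    have Cs: "C p \<in> sets \<mu>" using sets_local_set[OF sets_eq KC(1,2)] p by auto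
    have Ds: "sym_diff p (C p) \<in> sets \<mu>" using ps Cs by auto
    \<comment> \<open>\<open>C p\<close> is visible in the window, so there the error set decides
      membership in \<open>p\<close>.\<close>
    have det: "x \<in> p \<longleftrightarrow> y \<in> p"
      if "x \<in> X" "y \<in> X" "x \<in> sym_diff p (C p) \<longleftrightarrow> y \<in> sym_diff p (C p)" "restrict x L = restrict y L" for x y
    proof -
      have "restrict x (K p) = restrict y (K p)"
        using that(4) p unfolding restrict_eq_restrict_iff L_def by blast
      then have "x \<in> C p \<longleftrightarrow> y \<in> C p"
        using KC(2)[OF p] that(1,2) unfolding local_sets_iff space_eq by blast
      then show ?thesis using that(3) by blast
    qed
    have "cond_ent \<mu> (\<lambda>x. x \<in> p) (\<lambda>x. restrict x L) \<le> cond_ent \<mu> (\<lambda>x. x \<in> sym_diff p (C p)) (\<lambda>x. restrict x L)"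
      by (rule cond_ent_mono[OF sp[OF Ds] sK[OF finL]], rule det) (simp_all only: space_eq)
    also have "\<dots> \<le> ent \<mu> (\<lambda>x. x \<in> sym_diff p (C p))"
      by (intro cond_ent_le_ent sp Ds sK finL)
    also have "\<dots> = eta (prob {x \<in> space \<mu>. x \<in> sym_diff p (C p)})
        + eta (1 - prob {x \<in> space \<mu>. x \<in> sym_diff p (C p)})"
      by (rule ent_pred[OF sp[OF Ds]])
    also have "{x \<in> space \<mu>. x \<in> sym_diff p (C p)} = sym_diff p (C p)"
      using sets.sets_into_space[OF Ds] by auto
    also have "eta (prob (sym_diff p (C p))) + eta (1 - prob (sym_diff p (C p))) < \<epsilon>"
      using KC(3)[OF p] by (intro small) auto
    finally show ?thesis by (rule less_imp_le)
  qed
  let ?r = "\<lambda>x. restrict (\<lambda>p. x \<in> p) P"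
  have det: "cell P x = cell P y" if "x \<in> X" "y \<in> X" "?r x = ?r y" for x y
    using cell_mem[OF P that(1)] that(3)
    by (intro cell_eqI[OF P, symmetric]) (auto simp: restrict_eq_restrict_iff)
  have spP: "simple_function \<mu> (\<lambda>x. x \<in> p)" if "p \<in> P" for p
    using that Ps by (intro sp) auto
  have "cond_ent \<mu> (cell P) (\<lambda>x. restrict x L) \<le> cond_ent \<mu> ?r (\<lambda>x. restrict x L)"
    by (rule cond_ent_mono[OF simple_function_restrict[OF finP spP] sK[OF finL]], assumption, rule det)
      (simp_all only: space_eq)
  also have "\<dots> \<le> (\<Sum>p\<in>P. cond_ent \<mu> (\<lambda>x. x \<in> p) (\<lambda>x. restrict x L))"
    by (intro cond_ent_restrict_le_sum spP finP sK finL)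
  also have "\<dots> \<le> (\<Sum>p\<in>P. \<epsilon>)" by (intro sum_mono one)
  also have "\<dots> = \<delta> * (real (card P) / (real (card P) + 1))" by (simp add: \<epsilon>_def)
  also have "\<dots> < \<delta> * 1" using d by (intro mult_strict_left_mono) auto
  finally show ?thesis using that finL by simp
qed

lemma cond_ent_shift:
  assumes f: "simple_function \<mu> f" and h: "simple_function \<mu> h"
  shows "cond_ent \<mu> (\<lambda>x. f (shift g x)) (\<lambda>x. h (shift g x)) = cond_ent \<mu> f h"
  using ent_shift[OF simple_function_Pair[OF f h]] ent_shift[OF h] by (simp add: cond_ent_def)

text \<open>The part of \<open>shift g x\<close> costs at most \<delta> once \<open>x\<close> is
  known on the translate of \<open>K\<close> at \<open>g\<close>. For this the window
  \<open>\<Phi> n\<close> is enlarged; the added symbols cost a bounded amount each, and their share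
  vanishes in the limit.\<close>

lemma partition_entropy_rate_le:
  fixes \<Phi> :: "nat \<Rightarrow> 'g set"
  assumes P: "finite_partition \<mu> P" and \<Phi>: "folner_sequence \<Phi>"
  shows "partition_entropy_rate \<mu> P \<le> partition_entropy_rate \<mu> zero_partition"
proof (rule field_le_epsilon)
  fix \<delta> :: real assume "\<delta> > 0"
  then obtain K where K: "finite K" "cond_ent \<mu> (cell P) (\<lambda>x. restrict x K) < \<delta>"
    by (rule small_conditional_entropy[OF P])
  have fin: "finite (\<Phi> n)" "\<Phi> n \<noteq> {}" for n using \<Phi> by (auto simp: folner_sequence_def)
  let ?X = "\<lambda>S x. restrict x S" and ?T = "\<lambda>n. translates (\<Phi> n) K"
  have sX: "simple_function \<mu> (?X S)" if "finite S" for S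
    using simple_function_restrict[OF that, of \<mu> "\<lambda>i x. x i"] simple_coordinate by simp
  have jX: "joint_ent \<mu> (\<lambda>g x. x g) S = ent \<mu> (?X S)" for S by (simp add: joint_ent_def)
  have main: "joint_ent \<mu> (\<lambda>g x. cell P (shift g x)) (\<Phi> n) / real (card (\<Phi> n))
      \<le> joint_ent \<mu> (\<lambda>g x. x g) (\<Phi> n) / real (card (\<Phi> n))
        + real (card (?T n - \<Phi> n)) / real (card (\<Phi> n)) * real CARD('a) + \<delta>" for n
  proof -
    let ?c = "\<lambda>x. restrict (\<lambda>g. cell P (shift g x)) (\<Phi> n)" and ?D = "?T n - \<Phi> n"
    have finT: "finite (?T n)" using fin K by (intro finite_translates)
    have sc: "simple_function \<mu> ?c"
      using fin by (intro simple_function_restrict simple_shift simple_cell P)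
    have finD: "finite ?D" using finT by simp
    have "ent \<mu> ?c \<le> ent \<mu> (\<lambda>x. (?c x, ?X ?D x, ?X (\<Phi> n) x))"
      using fin finD by (intro ent_mono simple_function_Pair sc sX) auto
    also have "\<dots> = ent \<mu> (?X (\<Phi> n)) + cond_ent \<mu> (?X ?D) (?X (\<Phi> n)) + cond_ent \<mu> ?c (\<lambda>x. (?X ?D x, ?X (\<Phi> n) x))"
      by (simp add: cond_ent_def)
    also have "cond_ent \<mu> (?X ?D) (?X (\<Phi> n)) \<le> real (card ?D) * real CARD('a)"
    proof -
      have "cond_ent \<mu> (?X ?D) (?X (\<Phi> n)) \<le> (\<Sum>d\<in>?D. cond_ent \<mu> (\<lambda>x. x d) (?X (\<Phi> n)))"
        by (rule cond_ent_restrict_le_sum[OF finD simple_coordinate sX[OF fin(1)]])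
      also have "\<dots> \<le> (\<Sum>d\<in>?D. real CARD('a))"
        using cond_ent_le_ent[OF simple_coordinate sX[OF fin(1)]] ent_le_card[OF simple_coordinate finite_class.finite_UNIV]
        by (intro sum_mono) (meson order.trans subset_UNIV)
      finally show ?thesis by simp
    qed
    also have "cond_ent \<mu> ?c (\<lambda>x. (?X ?D x, ?X (\<Phi> n) x)) \<le> real (card (\<Phi> n)) * \<delta>"
    proof -
      have "cond_ent \<mu> ?c (\<lambda>x. (?X ?D x, ?X (\<Phi> n) x))
          \<le> (\<Sum>g\<in>\<Phi> n. cond_ent \<mu> (\<lambda>x. cell P (shift g x)) (\<lambda>x. (?X ?D x, ?X (\<Phi> n) x)))"
        using fin finD
        by (intro cond_ent_restrict_le_sum simple_function_Pair simple_shift simple_cell P sX)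
      also have "\<dots> \<le> (\<Sum>g\<in>\<Phi> n. \<delta>)"
      proof (rule sum_mono)
        fix g assume g: "g \<in> \<Phi> n"
        have det: "?X K (shift g x) = ?X K (shift g y)"
          if "(?X ?D x, ?X (\<Phi> n) x) = (?X ?D y, ?X (\<Phi> n) y)" for x y
        proof -
          have "g + k \<in> ?D \<union> \<Phi> n" if "k \<in> K" for k using that g by (auto simp: translates_def)
          then show ?thesis using that by (auto simp: restrict_eq_restrict_iff shift_def)
        qed
        have "cond_ent \<mu> (\<lambda>x. cell P (shift g x)) (\<lambda>x. (?X ?D x, ?X (\<Phi> n) x))
            \<le> cond_ent \<mu> (\<lambda>x. cell P (shift g x)) (\<lambda>x. ?X K (shift g x))"
          by (intro cond_ent_mono_cond simple_function_Pair simple_cell[THEN simple_shift] P sX[THEN simple_shift] sX fin finD K)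
            (erule det)
        also have "\<dots> = cond_ent \<mu> (cell P) (?X K)" by (intro cond_ent_shift simple_cell P sX K)
        finally show "cond_ent \<mu> (\<lambda>x. cell P (shift g x)) (\<lambda>x. (?X ?D x, ?X (\<Phi> n) x)) \<le> \<delta>" using K by simp
      qed
      finally show ?thesis by simp
    qed
    finally have "joint_ent \<mu> (\<lambda>g x. cell P (shift g x)) (\<Phi> n)
      \<le> joint_ent \<mu> (\<lambda>g x. x g) (\<Phi> n) + real (card ?D) * real CARD('a) + real (card (\<Phi> n)) * \<delta>"
      by (simp only: jX) (simp only: joint_ent_def)
    then have "joint_ent \<mu> (\<lambda>g x. cell P (shift g x)) (\<Phi> n) / real (card (\<Phi> n))
      \<le> (joint_ent \<mu> (\<lambda>g x. x g) (\<Phi> n) + real (card ?D) * real CARD('a) + real (card (\<Phi> n)) * \<delta>) / real (card (\<Phi> n))"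
      by (rule divide_right_mono) simp
    also have "\<dots> = joint_ent \<mu> (\<lambda>g x. x g) (\<Phi> n) / real (card (\<Phi> n))
        + real (card ?D) / real (card (\<Phi> n)) * real CARD('a) + \<delta>"
      using fin[of n] by (simp add: add_divide_distrib card_gt_0_iff)
    finally show ?thesis .
  qed
  have "(\<lambda>n. joint_ent \<mu> (\<lambda>g x. x g) (\<Phi> n) / real (card (\<Phi> n))
        + real (card (?T n - \<Phi> n)) / real (card (\<Phi> n)) * real CARD('a) + \<delta>)
      \<longlonglongrightarrow> partition_entropy_rate \<mu> zero_partition + 0 * real CARD('a) + \<delta>"
    by (intro tendsto_intros zero_partition_limit folner_sequence_translates_diff \<Phi> K)
  from LIMSEQ_le[OF partition_entropy_rate_limit[OF P \<Phi>] this] main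
  show "partition_entropy_rate \<mu> P \<le> partition_entropy_rate \<mu> zero_partition + \<delta>" by auto
qed

lemma ks_entropy_eq:
  fixes \<Phi> :: "nat \<Rightarrow> 'g set"
  assumes \<Phi>: "folner_sequence \<Phi>"
  shows "ks_entropy \<mu> = ereal (partition_entropy_rate \<mu> zero_partition)"
  unfolding ks_entropy_def
proof (rule antisym)
  show "(SUP P\<in>{P. finite_partition \<mu> P}. ereal (partition_entropy_rate \<mu> P))
      \<le> ereal (partition_entropy_rate \<mu> zero_partition)"
    using partition_entropy_rate_le[OF _ \<Phi>] by (intro SUP_least) simp
  show "ereal (partition_entropy_rate \<mu> zero_partition)
      \<le> (SUP P\<in>{P. finite_partition \<mu> P}. ereal (partition_entropy_rate \<mu> P))"
    using finite_partition_zero by (intro SUP_upper) simp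
qed

end

section \<open>Replacing occurrences of a pattern\<close>

definition occurs :: "'g::group_add set \<Rightarrow> ('g \<Rightarrow> 'a) \<Rightarrow> ('g \<Rightarrow> 'a) \<Rightarrow> 'g \<Rightarrow> bool"
  where "occurs F v x g \<longleftrightarrow> (\<forall>f\<in>F. x (g + f) = v f)"

text \<open>The translates of \<open>F\<close> at \<open>g\<close> and \<open>g'\<close> meet
  exactly when \<open>g'\<close> is \<open>g + d\<close> for some \<open>d\<close> in this set,
  since \<open>g + f = g' + f'\<close> means \<open>g' = g + (f - f')\<close>.\<close>

definition differences :: "'g::group_add set \<Rightarrow> 'g set"
  where "differences F = (\<lambda>(f, f'). f - f') ` (F \<times> F)"

text \<open>Isolation is demanded of the choices \<xi>, not of the occurrences, so overlapping
  occurrences of \<open>v\<close> in \<open>x\<close> do no harm.\<close>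

definition site :: "'g::group_add set \<Rightarrow> ('g \<Rightarrow> 'a) \<Rightarrow> ('g \<Rightarrow> 'a) \<Rightarrow> ('g \<Rightarrow> bool) \<Rightarrow> 'g \<Rightarrow> bool"
  where "site F v x \<xi> g \<longleftrightarrow> occurs F v x g \<and> \<xi> g \<and> (\<forall>d\<in>differences F - {0}. \<not> \<xi> (g + d))"

definition separated :: "'g::group_add set \<Rightarrow> ('g \<Rightarrow> bool) \<Rightarrow> bool"
  where "separated F R \<longleftrightarrow>
    (\<forall>g g' f f'. R g \<longrightarrow> R g' \<longrightarrow> f \<in> F \<longrightarrow> f' \<in> F \<longrightarrow> g + f = g' + f' \<longrightarrow> g = g')"

text \<open>If \<open>R\<close> is \<open>separated\<close>, at most one \<open>f\<close> qualifies
  and \<open>SOME\<close> has no freedom; \<open>replace_at\<close> rests on this.\<close>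

definition replace :: "'g::group_add set \<Rightarrow> ('g \<Rightarrow> 'a) \<Rightarrow> ('g \<Rightarrow> bool) \<Rightarrow> ('g \<Rightarrow> 'a) \<Rightarrow> 'g \<Rightarrow> 'a"
  where "replace F w R x h =
    (if \<exists>f\<in>F. R (h - f) then w (SOME f. f \<in> F \<and> R (h - f)) else x h)"

lemma finite_differences: "finite F \<Longrightarrow> finite (differences F)"
  by (simp add: differences_def)

lemma separatedD:
  "separated F R \<Longrightarrow> R g \<Longrightarrow> R g' \<Longrightarrow> f \<in> F \<Longrightarrow> f' \<in> F \<Longrightarrow> g + f = g' + f' \<Longrightarrow> g = g'"
  unfolding separated_def by blast

lemma separated_site: "separated F (site F v x \<xi>)"
  unfolding separated_def
proof (intro allI impI, rule ccontr)
  fix g g' f f'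
  assume s: "site F v x \<xi> g" "site F v x \<xi> g'" and f: "f \<in> F" "f' \<in> F"
    and e: "g + f = g' + f'" and n: "g \<noteq> g'"
  have "g' = g + f - f'" using e by simp
  then have g': "g' = g + (f - f')" by (simp add: add_diff_eq)
  then have "f - f' \<in> differences F - {0}" using n f by (auto simp: differences_def)
  then show False using s unfolding site_def g' by blast
qed

lemma replace_at:
  assumes R: "separated F R" and g: "R g" and f: "f \<in> F"
  shows "replace F w R x (g + f) = w f"
proof -
  have u: "f' = f" if "f' \<in> F" "R (g + f - f')" for f'
  proof -
    have "g + f - f' = g" using separatedD[OF R that(2) g that(1) f] by simp
    then have "g + f = g + f'" by (metis diff_eq_eq)
    then show ?thesis by simp
  qed
  have "f \<in> F \<and> R (g + f - f)" using f g by simp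
  moreover from this have "(SOME f'. f' \<in> F \<and> R (g + f - f')) = f"
    using u by (intro some_equality) auto
  ultimately show ?thesis unfolding replace_def by auto
qed

lemma replace_off: "(\<And>f. f \<in> F \<Longrightarrow> \<not> R (h - f)) \<Longrightarrow> replace F w R x h = x h"
  by (simp add: replace_def)

text \<open>The old pattern at each site of \<open>R\<close> is known to be \<open>v\<close>, and
  nothing changes elsewhere, so writing \<open>v\<close> back undoes the replacement.\<close>

lemma replace_replace:
  assumes R: "separated F R" and occ: "\<And>g. R g \<Longrightarrow> occurs F v x g"
  shows "replace F v R (replace F w R x) = x"
proof
  fix h show "replace F v R (replace F w R x) h = x h"
  proof (cases "\<exists>f\<in>F. R (h - f)")
    case True
    then obtain f where f: "f \<in> F" "R (h - f)" by blast
    have "replace F v R (replace F w R x) (h - f + f) = v f"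
      by (rule replace_at[OF R f(2,1)])
    moreover have "x (h - f + f) = v f" using occ[OF f(2)] f(1) unfolding occurs_def by blast
    ultimately show ?thesis by simp
  next
    case False
    then show ?thesis by (simp add: replace_def)
  qed
qed

text \<open>This locality gives the measurability of the replaced configuration and the reduction to
  finite windows.\<close>

lemma replace_cong_local:
  assumes "\<And>f. f \<in> F \<Longrightarrow> R (h - f) = R' (h - f)" "x h = x' h"
  shows "replace F w R x h = replace F w R' x' h"
proof -
  have "(\<lambda>f. f \<in> F \<and> R (h - f)) = (\<lambda>f. f \<in> F \<and> R' (h - f))" using assms(1) by auto
  moreover from this have "(\<exists>f\<in>F. R (h - f)) = (\<exists>f\<in>F. R' (h - f))" by meson
  ultimately show ?thesis unfolding replace_def using assms(2) by simp
qed

lemma site_shift: "site F v (shift k x) (shift k \<xi>) = shift k (site F v x \<xi>)"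
  by (simp add: site_def occurs_def shift_def fun_eq_iff add.assoc)

lemma replace_shift: "replace F w (shift k R) (shift k x) = shift k (replace F w R x)"
  by (simp add: replace_def shift_def fun_eq_iff add_diff_eq)

text \<open>The sites are treated one at a time. Earlier replacements do not touch the translate of
  \<open>F\<close> at the next site, which therefore still shows \<open>v\<close>; moved to the
  origin, its surroundings extend \<open>v\<close>, hence also \<open>w\<close>.\<close>

lemma replace_finite_in_subshift:
  fixes X :: "('g::group_add \<Rightarrow> 'a::discrete_topology) set"
  assumes X: "subshift X" and ext: "extender_set X F v \<subseteq> extender_set X F w" and x: "x \<in> X"
  shows "finite A \<Longrightarrow> separated F (\<lambda>g. g \<in> A) \<Longrightarrow> (\<And>g. g \<in> A \<Longrightarrow> occurs F v x g) \<Longrightarrow>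
    replace F w (\<lambda>g. g \<in> A) x \<in> X"
proof (induction A rule: finite_induct)
  case empty
  have "replace F w (\<lambda>g. g \<in> {}) x = x" by (simp add: replace_def fun_eq_iff)
  then show ?case using x by simp
next
  case (insert g A)
  let ?z = "replace F w (\<lambda>g. g \<in> A) x"
  have sep: "separated F (\<lambda>g. g \<in> A)"
    using insert.prems(1) unfolding separated_def by blast
  have z: "?z \<in> X" using insert.IH[OF sep] insert.prems(2) by blast
  have off: "g + f - f' \<notin> A" if "f \<in> F" "f' \<in> F" for f f'
  proof
    assume "g + f - f' \<in> A"
    then have "g + f - f' = g"
      using separatedD[OF insert.prems(1), of "g + f - f'" g f' f] that by auto
    then show False using \<open>g + f - f' \<in> A\<close> insert.hyps by simp
  qed
  have zg: "?z (g + f) = v f" if "f \<in> F" for f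
  proof -
    have "?z (g + f) = x (g + f)" using off[OF that] by (rule replace_off)
    then show ?thesis using insert.prems(2)[of g] that by (auto simp: occurs_def)
  qed
  \<comment> \<open>The surroundings of the occurrence, seen from \<open>g\<close>.\<close>
  define \<eta> where "\<eta> = restrict (shift g ?z) (- F)"
  have "override_on \<eta> v F = shift g ?z"
    using zg by (auto simp: \<eta>_def override_on_def fun_eq_iff shift_def)
  then have "\<eta> \<in> extender_set X F v"
    using z X by (auto simp: extender_set_def \<eta>_def subshift_def)
  then have "override_on \<eta> w F \<in> X" using ext by (auto simp: extender_set_def)
  then have "shift (- g) (override_on \<eta> w F) \<in> X" using X by (auto simp: subshift_def)
  also have "shift (- g) (override_on \<eta> w F) = replace F w (\<lambda>h. h \<in> insert g A) x"
  proof
    fix h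
    show "shift (- g) (override_on \<eta> w F) h = replace F w (\<lambda>h. h \<in> insert g A) x h"
    proof (cases "- g + h \<in> F")
      case True
      have "replace F w (\<lambda>h. h \<in> insert g A) x (g + (- g + h)) = w (- g + h)"
        by (rule replace_at[OF insert.prems(1) _ True]) simp
      moreover have "g + (- g + h) = h" by (simp add: add.assoc[symmetric])
      ultimately show ?thesis using True by (simp add: shift_def override_on_def)
    next
      case False
      have "g + (- g + h) = h" by (simp add: add.assoc[symmetric])
      then have "shift (- g) (override_on \<eta> w F) h = ?z h"
        using False by (simp add: shift_def override_on_def \<eta>_def)
      also have "\<dots> = replace F w (\<lambda>h. h \<in> insert g A) x h"
      proof (rule replace_cong_local)
        fix f assume "f \<in> F"
        then have "h - f \<noteq> g" using False by (metis diff_add_cancel minus_add_cancel)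
        then show "(h - f \<in> A) = (h - f \<in> insert g A)" by simp
      qed simp
      finally show ?thesis .
    qed
  qed
  finally show ?case .
qed

text \<open>By closedness a finite window \<open>K\<close> may be considered, and only the finitely
  many sites \<open>h - f\<close> with \<open>h\<close> in \<open>K\<close> and \<open>f\<close> in
  \<open>F\<close> influence it.\<close>

lemma replace_in_subshift:
  fixes X :: "('g::group_add \<Rightarrow> 'a::discrete_topology) set"
  assumes X: "subshift X" and ext: "extender_set X F v \<subseteq> extender_set X F w" and x: "x \<in> X"
    and F: "finite F" and R: "separated F R" and occ: "\<And>g. R g \<Longrightarrow> occurs F v x g"
  shows "replace F w R x \<in> X"
proof (rule closed_fun_memI)
  show "closed X" using X by (simp add: subshift_def)
  fix K :: "'g set" assume K: "finite K"
  define A where "A = {g \<in> (\<lambda>(h, f). h - f) ` (K \<times> F). R g}"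
  have "finite A" using K F by (simp add: A_def)
  moreover have "separated F (\<lambda>g. g \<in> A)" using R unfolding separated_def A_def by blast
  moreover have "occurs F v x g" if "g \<in> A" for g using that occ by (simp add: A_def)
  ultimately have "replace F w (\<lambda>g. g \<in> A) x \<in> X"
    by (rule replace_finite_in_subshift[OF X ext x])
  moreover have "replace F w (\<lambda>g. g \<in> A) x h = replace F w R x h" if "h \<in> K" for h
    using that by (intro replace_cong_local) (auto simp: A_def)
  ultimately show "\<exists>z\<in>X. \<forall>i\<in>K. z i = replace F w R x i" by blast
qed

section \<open>Entropy estimates\<close>

text \<open>For quantities that depend on finitely many coordinates: they factor through the tuple
  of these coordinates.\<close>

lemma simple_function_determined:
  assumes g: "simple_function M g"
    and det: "\<And>x y. x \<in> space M \<Longrightarrow> y \<in> space M \<Longrightarrow> g x = g y \<Longrightarrow> f x = f y"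
  shows "simple_function M f"
proof -
  define \<phi> where "\<phi> b = f (inv_into (space M) g b)" for b
  have "f x = \<phi> (g x)" if "x \<in> space M" for x
    unfolding \<phi>_def using that
    by (intro det) (auto intro: inv_into_into f_inv_into_f[symmetric])
  then have "simple_function M f \<longleftrightarrow> simple_function M (\<lambda>x. \<phi> (g x))"
    by (rule simple_function_cong)
  then show ?thesis using simple_function_compose1[OF g] by blast
qed

text \<open>The left side is the entropy of an event of mass \<open>r\<close> inside one of mass
  \<open>q\<close>. It is at most \<open>r * (1 + ln (q / r))\<close>, which increases in
  \<open>q\<close>, and in \<open>r\<close> up to \<open>q\<close>, so upper bounds for the masses
  may be inserted.\<close>

lemma eta_diff_le:
  assumes "0 \<le> r" "r \<le> q" "r \<le> r'" "q \<le> q'" "0 < r'" "r' \<le> q'"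
  shows "eta r + eta (q - r) - eta q \<le> r' * (1 + ln (q' / r'))"
proof (cases "r = 0")
  case True
  then show ?thesis using assms by simp
next
  case False
  then have r: "r > 0" and q: "q > 0" using assms by auto
  have 1: "- ((q - r) * ln (q - r)) + (q - r) * ln q \<le> r"
  proof (cases "q = r")
    case False
    then have qr: "q - r > 0" using assms by simp
    have "ln (q / (q - r)) \<le> q / (q - r) - 1" using qr q by (intro ln_le_minus_one) auto
    then have "(q - r) * ln (q / (q - r)) \<le> (q - r) * (q / (q - r) - 1)"
      using qr by (intro mult_left_mono) auto
    also have "\<dots> = r" using qr by (simp add: right_diff_distrib)
    finally show ?thesis using qr q by (simp add: ln_div right_diff_distrib)
  qed (use r in simp)
  have 2: "r * ln (r' / r) \<le> r' - r"
  proof -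
    have "ln (r' / r) \<le> r' / r - 1" using assms r by (intro ln_le_minus_one) auto
    then have "r * ln (r' / r) \<le> r * (r' / r - 1)" using r by (intro mult_left_mono) auto
    then show ?thesis using r by (simp add: right_diff_distrib)
  qed
  have 3: "r * ln q \<le> r * ln q'" using r q assms by (intro mult_left_mono) auto
  have 4: "r * ln (q' / r') \<le> r' * ln (q' / r')" using assms by (intro mult_right_mono) auto
  have "eta r + eta (q - r) - eta q = r * ln q - r * ln r + (- ((q - r) * ln (q - r)) + (q - r) * ln q)"
    by (simp add: eta_def algebra_simps)
  also have "\<dots> \<le> r * ln q' - r * ln r + r" using 1 3 by linarith
  also have "\<dots> = r * ln (q' / r') + r * ln (r' / r) + r"
    using r assms by (simp add: ln_div algebra_simps)
  also have "\<dots> \<le> r' * (1 + ln (q' / r'))" using 2 4 by (simp add: algebra_simps)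
  finally show ?thesis .
qed

context prob_space
begin

text \<open>On an atom of \<open>Z\<close> where \<open>V\<close> holds, the event has conditional
  probability \<epsilon>; on the others it is impossible. So only the mass of \<open>V\<close>
  carries the binary entropy of \<epsilon>.\<close>

lemma cond_ent_conj_independent:
  assumes U: "simple_function M U" and Z: "simple_function M Z"
    and V: "\<And>x. x \<in> space M \<Longrightarrow> V x \<longleftrightarrow> Q (Z x)"
    and ind: "\<And>z. prob {x \<in> space M. U x \<and> Z x = z} = \<epsilon> * prob {x \<in> space M. Z x = z}"
  shows "cond_ent M (\<lambda>x. V x \<and> U x) Z = prob {x \<in> space M. V x} * (eta \<epsilon> + eta (1 - \<epsilon>))"
proof -
  let ?p = "\<lambda>z. prob {x \<in> space M. Z x = z}" and ?I = "Z ` space M"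
  have fin: "finite ?I" using Z by (rule simple_functionD)
  have lev: "{x \<in> space M. Z x = z} \<in> sets M" for z by (rule simple_function_level[OF Z])
  have levU: "{x \<in> space M. U x \<and> Z x = z} \<in> sets M" for z
    using simple_function_level[OF simple_function_Pair[OF U Z], of "(True, z)"] by simp
  have nU: "prob {x \<in> space M. \<not> U x \<and> Z x = z} = (1 - \<epsilon>) * ?p z" for z
  proof -
    have "{x \<in> space M. \<not> U x \<and> Z x = z} = {x \<in> space M. Z x = z} - {x \<in> space M. U x \<and> Z x = z}"
      by auto
    then have "prob {x \<in> space M. \<not> U x \<and> Z x = z} = ?p z - prob {x \<in> space M. U x \<and> Z x = z}"
      using finite_measure_Diff[OF lev levU, of z z] by auto
    then show ?thesis unfolding ind by (simp add: algebra_simps)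
  qed
  have et: "eta (c * p) = p * eta c + c * eta p" if "0 \<le> p" "0 \<le> c" for c p :: real
    using that by (cases "p = 0 \<or> c = 0") (auto simp: eta_def ln_mult algebra_simps)
  have z: "eta (prob {x \<in> space M. (V x \<and> U x) = True \<and> Z x = z})
      + eta (prob {x \<in> space M. (V x \<and> U x) = False \<and> Z x = z})
      = eta (?p z) + (if Q z then ?p z * (eta \<epsilon> + eta (1 - \<epsilon>)) else 0)" (is "eta ?a + eta ?b = _") for z
  proof (cases "Q z")
    case True
    then have "{x \<in> space M. (V x \<and> U x) = True \<and> Z x = z} = {x \<in> space M. U x \<and> Z x = z}"
      "{x \<in> space M. (V x \<and> U x) = False \<and> Z x = z} = {x \<in> space M. \<not> U x \<and> Z x = z}"
      using V by auto
    then have ab: "?a = \<epsilon> * ?p z" "?b = (1 - \<epsilon>) * ?p z" using ind nU by simp_all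
    \<comment> \<open>On an atom of positive mass the signs of \<open>\<epsilon>\<close> and
      \<open>1 - \<epsilon>\<close> are read off from these measures.\<close>
    have nn: "0 \<le> \<epsilon> * ?p z" "0 \<le> (1 - \<epsilon>) * ?p z"
      unfolding ind[symmetric] nU[symmetric] by simp_all
    show ?thesis
    proof (cases "?p z = 0")
      case False
      then have "?p z > 0" using measure_nonneg[of M "{x \<in> space M. Z x = z}"] by linarith
      then have "0 \<le> \<epsilon>" "0 \<le> 1 - \<epsilon>" using nn by (auto simp: zero_le_mult_iff)
      then have "eta (\<epsilon> * ?p z) + eta ((1 - \<epsilon>) * ?p z)
          = (?p z * eta \<epsilon> + \<epsilon> * eta (?p z)) + (?p z * eta (1 - \<epsilon>) + (1 - \<epsilon>) * eta (?p z))"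
        by (simp only: et measure_nonneg)
      then show ?thesis unfolding ab using True by (simp add: algebra_simps)
    next
      case p0: True
      show ?thesis unfolding ab p0 using True by simp
    qed
  next
    case False
    then have "{x \<in> space M. (V x \<and> U x) = True \<and> Z x = z} = {}"
      "{x \<in> space M. (V x \<and> U x) = False \<and> Z x = z} = {x \<in> space M. Z x = z}"
      using V by auto
    then show ?thesis using False by (simp only: measure_empty) simp
  qed
  have "ent M (\<lambda>x. (V x \<and> U x, Z x))
      = (\<Sum>y\<in>{True, False} \<times> ?I. eta (prob {x \<in> space M. (V x \<and> U x, Z x) = y}))"
    using fin by (intro ent_superset) auto
  also have "\<dots> = (\<Sum>b\<in>{True, False}. \<Sum>z\<in>?I. eta (prob {x \<in> space M. (V x \<and> U x) = b \<and> Z x = z}))"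
    by (simp only: sum.cartesian_product' prod.inject)
  also have "\<dots> = (\<Sum>z\<in>?I. eta (prob {x \<in> space M. (V x \<and> U x) = True \<and> Z x = z})
      + eta (prob {x \<in> space M. (V x \<and> U x) = False \<and> Z x = z}))"
    by (simp add: sum.distrib)
  also have "\<dots> = (\<Sum>z\<in>?I. eta (?p z) + (if Q z then ?p z * (eta \<epsilon> + eta (1 - \<epsilon>)) else 0))"
    by (intro sum.cong refl z)
  also have "\<dots> = ent M Z + (\<Sum>z\<in>?I. if Q z then ?p z else 0) * (eta \<epsilon> + eta (1 - \<epsilon>))"
    by (auto simp: sum.distrib ent_def sum_distrib_right intro!: sum.cong)
  also have "(\<Sum>z\<in>?I. if Q z then ?p z else 0) = prob {x \<in> space M. V x}"
  proof -
    have sV: "{x \<in> space M. V x} \<in> sets M"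
    proof -
      have "{x \<in> space M. V x} = Z -` {z. Q z} \<inter> space M" using V by auto
      then show ?thesis by (simp only: simple_functionD(2)[OF Z])
    qed
    have "prob {x \<in> space M. V x} = (\<Sum>z\<in>?I. prob {x \<in> {x \<in> space M. V x}. Z x = z})"
      using fin by (intro measure_level_sum[OF Z sV]) auto
    also have "\<dots> = (\<Sum>z\<in>?I. if Q z then ?p z else 0)"
    proof (intro sum.cong refl)
      fix z
      show "prob {x \<in> {x \<in> space M. V x}. Z x = z} = (if Q z then ?p z else 0)"
      proof (cases "Q z")
        case True
        then have "{x \<in> {x \<in> space M. V x}. Z x = z} = {x \<in> space M. Z x = z}" using V by auto
        then show ?thesis using True by simp
      next
        case False
        then have "{x \<in> {x \<in> space M. V x}. Z x = z} = {}" using V by auto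
        then show ?thesis using False by (simp only: measure_empty) simp
      qed
    qed
    finally show ?thesis by simp
  qed
  finally show ?thesis by (simp add: cond_ent_def)
qed

text \<open>\<open>R\<close> is impossible outside \<open>W\<close>, which leaves atoms of masses r,
  q - r and 1 - q for the pair.\<close>

lemma cond_ent_subset_le:
  assumes R: "simple_function M R" and W: "simple_function M W"
    and sub: "\<And>x. x \<in> space M \<Longrightarrow> R x \<Longrightarrow> W x"
    and r': "prob {x \<in> space M. R x} \<le> r'" and q': "prob {x \<in> space M. W x} \<le> q'"
    and pos: "0 < r'" "r' \<le> q'"
  shows "cond_ent M R W \<le> r' * (1 + ln (q' / r'))"
proof -
  define r where "r = prob {x \<in> space M. R x}"
  define q where "q = prob {x \<in> space M. W x}"
  have sR: "{x \<in> space M. R x} \<in> sets M" and sW: "{x \<in> space M. W x} \<in> sets M"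
    using simple_function_level[OF R, of True] simple_function_level[OF W, of True] by simp_all
  have rq: "r \<le> q" unfolding r_def q_def using sub sW by (intro finite_measure_mono) auto
  have 1: "{x \<in> space M. R x \<and> W x} = {x \<in> space M. R x}" using sub by auto
  have 2: "{x \<in> space M. R x \<and> \<not> W x} = {}" using sub by auto
  have 3: "prob {x \<in> space M. \<not> R x \<and> W x} = q - r"
  proof -
    have "{x \<in> space M. \<not> R x \<and> W x} = {x \<in> space M. W x} - {x \<in> space M. R x}" by auto
    then show ?thesis unfolding q_def r_def using sub sR sW by (simp add: finite_measure_Diff Collect_mono_iff subset_iff)
  qed
  have 4: "prob {x \<in> space M. \<not> R x \<and> \<not> W x} = 1 - q"
  proof -
    have "{x \<in> space M. \<not> R x \<and> \<not> W x} = {x \<in> space M. \<not> W x}" using sub by auto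
    then show ?thesis unfolding q_def using sW by (simp only: prob_neg)
  qed
  have "ent M (\<lambda>x. (R x, W x)) = (\<Sum>y\<in>{(True, True), (True, False), (False, True), (False, False)}.
      eta (prob {x \<in> space M. (R x, W x) = y}))"
    by (intro ent_superset) auto
  also have "\<dots> = eta r + eta (q - r) + eta (1 - q)"
    by (simp add: 1 2 3 4 del: not_ex) (simp add: r_def)
  finally have "cond_ent M R W = eta r + eta (q - r) - eta q"
    by (simp add: cond_ent_def ent_pred[OF W] q_def)
  also have "\<dots> \<le> r' * (1 + ln (q' / r'))"
    using rq r' q' pos by (intro eta_diff_le) (auto simp: r_def q_def)
  finally show ?thesis .
qed

lemma ent_pred_le:
  assumes P: "simple_function M P" and p: "prob {x \<in> space M. P x} \<le> p"
  shows "ent M P \<le> 4 * sqrt (sqrt p) ^ 3 + p"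
proof -
  let ?q = "prob {x \<in> space M. P x}"
  have "ent M P = eta ?q + eta (1 - ?q)" by (rule ent_pred[OF P])
  also have "\<dots> \<le> 4 * sqrt (sqrt ?q) ^ 3 + ?q"
    using eta_le_root[of ?q] eta_le_1_minus[of "1 - ?q"] by simp
  also have "\<dots> \<le> 4 * sqrt (sqrt p) ^ 3 + p"
    using p by (intro add_mono mult_left_mono power_mono) auto
  finally show ?thesis .
qed

end

section \<open>Random replacement\<close>

definition coin_flips :: "real \<Rightarrow> ('g \<Rightarrow> bool) measure"
  where "coin_flips \<epsilon> = Pi\<^sub>M UNIV (\<lambda>_. measure_pmf (bernoulli_pmf \<epsilon>))"

lemma space_coin_flips [simp]: "space (coin_flips \<epsilon>) = UNIV"
  by (simp add: coin_flips_def space_PiM)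

lemma prob_space_coin_flips: "prob_space (coin_flips \<epsilon>)"
  unfolding coin_flips_def by (intro prob_space_PiM measure_pmf.prob_space_axioms)

lemma simple_function_coin_flips: "simple_function (coin_flips \<epsilon>) (\<lambda>\<xi>. \<xi> g)"
proof -
  have "(\<lambda>\<xi>. \<xi> g) \<in> measurable (coin_flips \<epsilon>) (measure_pmf (bernoulli_pmf \<epsilon>))"
    unfolding coin_flips_def by measurable
  then have "(\<lambda>\<xi>. \<xi> g) \<in> measurable (coin_flips \<epsilon>) (count_space UNIV)"
    by (simp cong: measurable_cong_sets)
  moreover have "simple_function (count_space UNIV) (\<lambda>b :: bool. b)"
    by (simp add: simple_function_def)
  ultimately show ?thesis by (rule simple_function_comp)
qed

lemma measure_coin_flips:
  assumes \<epsilon>: "0 \<le> \<epsilon>" "\<epsilon> \<le> 1" and J: "finite J"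
  shows "measure (coin_flips \<epsilon>) {\<xi>. \<forall>j\<in>J. \<xi> j = p j} = (\<Prod>j\<in>J. if p j then \<epsilon> else 1 - \<epsilon>)"
proof -
  interpret product_prob_space "\<lambda>_ :: 'a. measure_pmf (bernoulli_pmf \<epsilon>)" UNIV
    by unfold_locales
  have "emb UNIV J (Pi\<^sub>E J (\<lambda>j. {p j})) = {\<xi>. \<forall>j\<in>J. \<xi> j = p j}"
    by (rule set_eqI) (simp add: prod_emb_def space_PiM PiE_iff)
  then have "measure (coin_flips \<epsilon>) {\<xi>. \<forall>j\<in>J. \<xi> j = p j}
      = (\<Prod>j\<in>J. measure (measure_pmf (bernoulli_pmf \<epsilon>)) {p j})"
    using measure_PiM_emb[of J "\<lambda>j. {p j}"] J by (simp add: coin_flips_def)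
  also have "\<dots> = (\<Prod>j\<in>J. if p j then \<epsilon> else 1 - \<epsilon>)"
    using \<epsilon> by (intro prod.cong) (auto simp: measure_pmf_single)
  finally show ?thesis .
qed

text \<open>Left translation is an injective reindexing of independent, identically distributed
  coins.\<close>

lemma distr_coin_flips_shift:
  "distr (coin_flips \<epsilon>) (coin_flips \<epsilon>) (shift g) = coin_flips \<epsilon>"
proof -
  have "distr (Pi\<^sub>M UNIV (\<lambda>_. measure_pmf (bernoulli_pmf \<epsilon>))) (Pi\<^sub>M UNIV (\<lambda>_. measure_pmf (bernoulli_pmf \<epsilon>)))
      (\<lambda>\<omega>. \<lambda>n\<in>UNIV. \<omega> (g + n)) = Pi\<^sub>M UNIV (\<lambda>_. measure_pmf (bernoulli_pmf \<epsilon>))"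
    by (intro distr_PiM_reindex measure_pmf.prob_space_axioms) auto
  then show ?thesis by (simp add: coin_flips_def shift_def[abs_def] restrict_def)
qed

lemma measurable_coin_flips_shift: "shift g \<in> measurable (coin_flips \<epsilon>) (coin_flips \<epsilon>)"
  unfolding coin_flips_def shift_def[abs_def]
  by (rule measurable_PiM_single') (auto simp: space_PiM intro!: measurable_component_singleton)

section \<open>The replaced configuration and its law\<close>

locale random_replacement = invariant_subshift X \<mu>
  for X :: "('g::{group_add, countable} \<Rightarrow> 'a::{finite, discrete_topology}) set" and \<mu> +
  fixes F :: "'g set" and v w :: "'g \<Rightarrow> 'a" and \<epsilon> :: real
  assumes F: "finite F" "F \<noteq> {}"
    and ext: "extender_set X F v \<subseteq> extender_set X F w"
    and \<epsilon>: "0 < \<epsilon>" "\<epsilon> < 1"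
begin

definition \<Omega> :: "(('g \<Rightarrow> 'a) \<times> ('g \<Rightarrow> bool)) measure"
  where "\<Omega> = \<mu> \<Otimes>\<^sub>M coin_flips \<epsilon>"

sublocale B: prob_space "coin_flips \<epsilon>"
  by (rule prob_space_coin_flips)

sublocale pair: pair_prob_space \<mu> "coin_flips \<epsilon>" ..

sublocale \<Omega>: prob_space \<Omega>
  unfolding \<Omega>_def by (rule pair.prob_space_axioms)

lemma space_\<Omega>: "space \<Omega> = X \<times> UNIV"
  by (simp add: \<Omega>_def space_pair_measure space_eq)

lemma measurable_fst_\<Omega>: "fst \<in> measurable \<Omega> \<mu>"
  by (simp add: \<Omega>_def)

lemma measurable_snd_\<Omega>: "snd \<in> measurable \<Omega> (coin_flips \<epsilon>)"
  by (simp add: \<Omega>_def)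

lemma distr_fst: "distr \<Omega> \<mu> fst = \<mu>"
  unfolding \<Omega>_def by (rule B.distr_pair_fst)

lemma simple_fst: "simple_function \<mu> f \<Longrightarrow> simple_function \<Omega> (\<lambda>\<omega>. f (fst \<omega>))"
  by (rule simple_function_comp[OF measurable_fst_\<Omega>])

lemma simple_x [simp]: "simple_function \<Omega> (\<lambda>\<omega>. fst \<omega> g)"
  by (rule simple_fst[OF simple_coordinate])

lemma simple_xi [simp]: "simple_function \<Omega> (\<lambda>\<omega>. snd \<omega> g)"
  by (rule simple_function_comp[OF measurable_snd_\<Omega> simple_function_coin_flips])

lemma measure_times:
  assumes "A \<in> sets \<mu>" "C \<in> sets (coin_flips \<epsilon>)"
  shows "measure \<Omega> (A \<times> C) = measure \<mu> A * measure (coin_flips \<epsilon>) C"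
  unfolding \<Omega>_def using assms
  by (simp add: measure_def B.emeasure_pair_measure_Times enn2real_mult)

text \<open>\<open>Z\<close> reveals \<open>x\<close> on a window and coins other than the one at
  \<open>g\<close>, which stays independent of them. The form matches the hypothesis
  \<open>ind\<close> of \<open>cond_ent_conj_independent\<close>.\<close>

lemma xi_independent:
  assumes "finite T" "finite S" "g \<notin> S"
  defines "Z \<equiv> \<lambda>\<omega>. (restrict (snd \<omega>) S, restrict (fst \<omega>) T)"
  shows "measure \<Omega> {\<omega> \<in> space \<Omega>. snd \<omega> g \<and> Z \<omega> = z} = \<epsilon> * measure \<Omega> {\<omega> \<in> space \<Omega>. Z \<omega> = z}"
proof -
  obtain s a where z: "z = (s, a)" by force
  let ?A = "{x \<in> space \<mu>. restrict x T = a}"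
  have A: "?A \<in> sets \<mu>"
    using assms by (intro simple_function_level simple_function_restrict_fun) auto
  have sxi: "simple_function (coin_flips \<epsilon>) (\<lambda>\<xi>. restrict \<xi> S)"
    using assms by (intro simple_function_restrict_fun simple_function_coin_flips)
  have C: "{\<xi>. restrict \<xi> S = s} \<in> sets (coin_flips \<epsilon>)"
    using simple_function_level[OF sxi, of s] by simp
  have C': "{\<xi>. \<xi> g \<and> restrict \<xi> S = s} \<in> sets (coin_flips \<epsilon>)"
    using simple_function_level[OF simple_function_Pair[OF simple_function_coin_flips[of \<epsilon> g] sxi], of "(True, s)"] by simp
  have e: "{\<omega> \<in> space \<Omega>. Z \<omega> = z} = ?A \<times> {\<xi>. restrict \<xi> S = s}"
    by (auto simp: space_\<Omega> space_eq z Z_def)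
  have e': "{\<omega> \<in> space \<Omega>. snd \<omega> g \<and> Z \<omega> = z} = ?A \<times> {\<xi>. \<xi> g \<and> restrict \<xi> S = s}"
    by (auto simp: space_\<Omega> space_eq z Z_def)
  have "measure (coin_flips \<epsilon>) {\<xi>. \<xi> g \<and> restrict \<xi> S = s} = \<epsilon> * measure (coin_flips \<epsilon>) {\<xi>. restrict \<xi> S = s}"
  proof (cases "s \<in> extensional S")
    case True
    have 1: "{\<xi>. restrict \<xi> S = s} = {\<xi>. \<forall>j\<in>S. \<xi> j = s j}"
      using True by (auto simp: extensional_def restrict_def fun_eq_iff)
    have 2: "{\<xi>. \<xi> g \<and> restrict \<xi> S = s} = {\<xi>. \<forall>j\<in>insert g S. \<xi> j = (s(g := True)) j}"
      using True assms(3) by (auto simp: extensional_def restrict_def fun_eq_iff)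
    show ?thesis
      unfolding 1 2 using assms(1-3) \<epsilon>
      by (subst (1 2) measure_coin_flips) (auto intro!: prod.cong)
  next
    case False
    then have "{\<xi>. restrict \<xi> S = s} = {}" "{\<xi>. \<xi> g \<and> restrict \<xi> S = s} = {}" by auto
    then show ?thesis by (simp only: measure_empty)
  qed
  then show ?thesis unfolding e e' measure_times[OF A C] measure_times[OF A C'] by simp
qed

lemma measure_xi: "measure \<Omega> {\<omega> \<in> space \<Omega>. snd \<omega> g} = \<epsilon>"
proof -
  have "{\<omega> \<in> space \<Omega>. snd \<omega> g} = space \<mu> \<times> {\<xi>. \<forall>j\<in>{g}. \<xi> j = True}"
    by (auto simp: space_\<Omega> space_eq)
  moreover have "{\<xi>. \<forall>j\<in>{g}. \<xi> j = True} \<in> sets (coin_flips \<epsilon>)"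
    using simple_function_level[OF simple_function_coin_flips, of \<epsilon> g True] by simp
  ultimately show ?thesis
    using measure_times[OF sets.top, of "{\<xi>. \<forall>j\<in>{g}. \<xi> j = True}"]
      measure_coin_flips[of \<epsilon> "{g}" "\<lambda>_. True"] \<epsilon> by (simp add: prob_space)
qed

lemma measure_xi_xi:
  assumes "g \<noteq> h"
  shows "measure \<Omega> {\<omega> \<in> space \<Omega>. snd \<omega> g \<and> snd \<omega> h} = \<epsilon>\<^sup>2"
proof -
  have "{\<omega> \<in> space \<Omega>. snd \<omega> g \<and> snd \<omega> h} = space \<mu> \<times> {\<xi>. \<forall>j\<in>{g, h}. \<xi> j = True}"
    by (auto simp: space_\<Omega> space_eq)
  moreover have "{\<xi>. \<forall>j\<in>{g, h}. \<xi> j = True} \<in> sets (coin_flips \<epsilon>)"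
    using simple_function_level[OF simple_function_Pair[OF
          simple_function_coin_flips[of \<epsilon> g] simple_function_coin_flips[of \<epsilon> h]], of "(True, True)"] by simp
  ultimately show ?thesis
    using measure_times[OF sets.top, of "{\<xi>. \<forall>j\<in>{g, h}. \<xi> j = True}"]
      measure_coin_flips[of \<epsilon> "{g, h}" "\<lambda>_. True"] \<epsilon> assms by (simp add: prob_space power2_eq_square)
qed

definition R :: "'g \<Rightarrow> ('g \<Rightarrow> 'a) \<times> ('g \<Rightarrow> bool) \<Rightarrow> bool"
  where "R g \<omega> = site F v (fst \<omega>) (snd \<omega>) g"

definition Y :: "('g \<Rightarrow> 'a) \<times> ('g \<Rightarrow> bool) \<Rightarrow> 'g \<Rightarrow> 'a"
  where "Y \<omega> = replace F w (\<lambda>g. R g \<omega>) (fst \<omega>)"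

lemma separated_R: "separated F (\<lambda>g. R g \<omega>)"
  unfolding R_def by (rule separated_site)

lemma R_occurs: "R g \<omega> \<Longrightarrow> occurs F v (fst \<omega>) g"
  by (simp add: R_def site_def)

lemma R_xi: "R g \<omega> \<Longrightarrow> snd \<omega> g"
  by (simp add: R_def site_def)

lemma Y_in: "\<omega> \<in> space \<Omega> \<Longrightarrow> Y \<omega> \<in> X"
  unfolding Y_def
  by (rule replace_in_subshift[OF subshift ext _ F(1) separated_R R_occurs]) (auto simp: space_\<Omega>)

lemma replace_Y: "replace F v (\<lambda>g. R g \<omega>) (Y \<omega>) = fst \<omega>"
  unfolding Y_def by (rule replace_replace[OF separated_R R_occurs])

lemma simple_occurs:
  assumes f: "\<And>g. simple_function M (\<lambda>\<omega>. f \<omega> g)"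
  shows "simple_function M (\<lambda>\<omega>. occurs F u (f \<omega>) g)"
proof (rule simple_function_determined)
  show "simple_function M (\<lambda>\<omega>. restrict (f \<omega>) ((+) g ` F))"
    using F f by (intro simple_function_restrict_fun) auto
qed (simp add: restrict_eq_restrict_iff occurs_def)

lemma simple_R [simp]: "simple_function \<Omega> (R g)"
proof (rule simple_function_determined)
  show "simple_function \<Omega> (\<lambda>\<omega>. (restrict (fst \<omega>) ((+) g ` F), restrict (snd \<omega>) ((+) g ` insert 0 (differences F))))"
    using F finite_differences[of F] by (intro simple_function_Pair simple_function_restrict_fun) auto
qed (simp add: restrict_eq_restrict_iff R_def site_def occurs_def)

lemma simple_Y [simp]: "simple_function \<Omega> (\<lambda>\<omega>. Y \<omega> h)"
proof (rule simple_function_determined)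
  show "simple_function \<Omega> (\<lambda>\<omega>. (restrict (\<lambda>f. R (h - f) \<omega>) F, fst \<omega> h))"
    using F by (intro simple_function_Pair simple_function_restrict) auto
  fix x y
  assume "(restrict (\<lambda>f. R (h - f) x) F, fst x h) = (restrict (\<lambda>f. R (h - f) y) F, fst y h)"
  then show "Y x h = Y y h"
    unfolding Y_def by (intro replace_cong_local) (simp_all add: restrict_eq_restrict_iff)
qed

lemma measurable_Y: "Y \<in> measurable \<Omega> \<mu>"
  using simple_function_level[OF simple_Y] by (intro measurable_into Y_in)

definition \<nu> :: "('g \<Rightarrow> 'a) measure"
  where "\<nu> = distr \<Omega> \<mu> Y"

text \<open>Replacement commutes with the shift, and the law \<Omega> of configuration and coins is
  invariant under the diagonal shift, so its image is invariant.\<close>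

lemma invariant_\<nu>: "invariant_measure X \<nu>"
  unfolding invariant_measure_def
proof (intro conjI allI)
  show "prob_space \<nu>" unfolding \<nu>_def by (rule \<Omega>.prob_space_distr[OF measurable_Y])
  show "sets \<nu> = sets (restrict_space borel X)" by (simp add: \<nu>_def sets_eq)
  fix g :: 'g
  let ?s = "\<lambda>(x, \<xi>). (shift g x, shift g \<xi>)"
  have ms: "?s \<in> measurable \<Omega> \<Omega>"
    unfolding \<Omega>_def using measurable_shift measurable_coin_flips_shift by measurable
  have "distr \<Omega> \<Omega> ?s = distr \<mu> \<mu> (shift g) \<Otimes>\<^sub>M distr (coin_flips \<epsilon>) (coin_flips \<epsilon>) (shift g)"
    unfolding \<Omega>_def
    by (rule pair_measure_distr[OF measurable_shift measurable_coin_flips_shift, symmetric])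
      (simp add: distr_coin_flips_shift B.sigma_finite_measure_axioms)
  also have "\<dots> = \<Omega>"
    using invariant by (simp add: distr_coin_flips_shift \<Omega>_def invariant_measure_def)
  finally have s: "distr \<Omega> \<Omega> ?s = \<Omega>" .
  have eq: "shift g (Y \<omega>) = Y (?s \<omega>)" for \<omega>
  proof -
    have "(\<lambda>h. R h (?s \<omega>)) = shift g (\<lambda>h. R h \<omega>)"
      unfolding R_def by (auto simp: split_def site_shift)
    then show ?thesis by (simp add: Y_def split_def replace_shift)
  qed
  have "distr \<nu> \<nu> (shift g) = distr \<nu> \<mu> (shift g)"
    by (rule distr_cong) (simp_all add: \<nu>_def)
  also have "\<dots> = distr \<Omega> \<mu> (\<lambda>\<omega>. shift g (Y \<omega>))"
    unfolding \<nu>_def by (subst distr_distr[OF measurable_shift measurable_Y]) (simp add: o_def)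
  also have "\<dots> = distr (distr \<Omega> \<Omega> ?s) \<mu> Y"
    by (subst distr_distr[OF measurable_Y ms]) (simp add: o_def eq)
  also have "\<dots> = \<nu>" unfolding s \<nu>_def ..
  finally show "distr \<nu> \<nu> (shift g) = \<nu>" .
qed

end

section \<open>The entropy gain\<close>

context random_replacement
begin

definition freq :: "('g \<Rightarrow> 'a) \<Rightarrow> real"
  where "freq u = measure \<mu> {x \<in> X. occurs F u x 0}"

definition num_diff :: real
  where "num_diff = real (card (differences F))"

text \<open>\<open>R\<close> without the isolation condition, which makes the sites independent once
  \<open>x\<close> is given.\<close>

definition U :: "'g \<Rightarrow> ('g \<Rightarrow> 'a) \<times> ('g \<Rightarrow> bool) \<Rightarrow> bool"
  where "U g \<omega> \<longleftrightarrow> occurs F v (fst \<omega>) g \<and> snd \<omega> g"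

lemma num_diff_ge_1: "1 \<le> num_diff"
proof -
  obtain f where "f \<in> F" using F by blast
  then have "0 \<in> differences F" by (force simp: differences_def)
  then have "card (differences F) > 0" using finite_differences[OF F(1)] by (auto simp: card_gt_0_iff)
  then show ?thesis by (simp add: num_diff_def)
qed

lemma freq_bounds: "0 \<le> freq u" "freq u \<le> 1"
  by (auto simp: freq_def)

lemma measure_occurs: "measure \<Omega> {\<omega> \<in> space \<Omega>. occurs F u (fst \<omega>) g} = freq u"
proof -
  have lev: "{x \<in> X. occurs F u x h} \<in> sets \<mu>" for h
    using simple_function_level[OF simple_occurs[where f = "\<lambda>x. x", OF simple_coordinate], of u h True] by (simp add: space_eq)
  have "measure \<mu> {x \<in> X. occurs F u x g} = measure (distr \<Omega> \<mu> fst) {x \<in> X. occurs F u x g}"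
    by (simp only: distr_fst)
  also have "\<dots> = measure \<Omega> (fst -` {x \<in> X. occurs F u x g} \<inter> space \<Omega>)"
    by (rule measure_distr[OF measurable_fst_\<Omega> lev])
  also have "fst -` {x \<in> X. occurs F u x g} \<inter> space \<Omega> = {\<omega> \<in> space \<Omega>. occurs F u (fst \<omega>) g}"
    by (auto simp: space_\<Omega>)
  finally have "measure \<Omega> {\<omega> \<in> space \<Omega>. occurs F u (fst \<omega>) g} = measure \<mu> {x \<in> X. occurs F u x g}" ..
  also have "{x \<in> X. occurs F u x g} = {x \<in> X. shift g x \<in> {x \<in> X. occurs F u x 0}}"
    by (auto simp: shift_in) (auto simp: occurs_def shift_def)
  also have "measure \<mu> \<dots> = freq u"
    unfolding freq_def by (rule measure_shift[OF lev])
  finally show ?thesis .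
qed

lemma simple_U [simp]: "simple_function \<Omega> (U g)"
proof (rule simple_function_determined)
  show "simple_function \<Omega> (\<lambda>\<omega>. (occurs F v (fst \<omega>) g, snd \<omega> g))"
    by (intro simple_function_Pair simple_occurs simple_x simple_xi)
qed (simp add: U_def)

text \<open>The coin at \<open>g\<close> is fresh even when the coins on \<open>S\<close> are known,
  and \<open>T\<close> is large enough to show whether \<open>v\<close> occurs at
  \<open>g\<close>.\<close>

lemma cond_ent_U:
  assumes "finite T" "finite S" "g \<notin> S" "(+) g ` F \<subseteq> T"
  shows "cond_ent \<Omega> (U g) (\<lambda>\<omega>. (restrict (snd \<omega>) S, restrict (fst \<omega>) T)) = freq v * (eta \<epsilon> + eta (1 - \<epsilon>))"
proof -
  have "cond_ent \<Omega> (\<lambda>\<omega>. occurs F v (fst \<omega>) g \<and> snd \<omega> g) (\<lambda>\<omega>. (restrict (snd \<omega>) S, restrict (fst \<omega>) T))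
      = measure \<Omega> {\<omega> \<in> space \<Omega>. occurs F v (fst \<omega>) g} * (eta \<epsilon> + eta (1 - \<epsilon>))"
  proof (rule \<Omega>.cond_ent_conj_independent[where Q = "\<lambda>(s, t). occurs F v t g"])
    show "simple_function \<Omega> (\<lambda>\<omega>. (restrict (snd \<omega>) S, restrict (fst \<omega>) T))"
      using assms by (intro simple_function_Pair simple_function_restrict_fun) auto
    show "occurs F v (fst \<omega>) g \<longleftrightarrow> (case (restrict (snd \<omega>) S, restrict (fst \<omega>) T) of (s, t) \<Rightarrow> occurs F v t g)"
      for \<omega> using assms(4) by (auto simp: occurs_def)
  qed (use xi_independent[OF assms(1-3)] in simp_all)
  then show ?thesis by (simp add: measure_occurs U_def[abs_def])
qed

text \<open>If \<open>U g\<close> holds and \<open>R g\<close> fails, a second coin is chosen at one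
  of at most \<open>num_diff\<close> neighbours, which has probability at most
  \<open>num_diff * \<epsilon>\<^sup>2\<close>. Given \<open>R g\<close>, this event decides
  \<open>U g\<close>.\<close>

lemma cond_ent_U_R: "cond_ent \<Omega> (U g) (R g) \<le> 4 * sqrt (sqrt (num_diff * \<epsilon>\<^sup>2)) ^ 3 + num_diff * \<epsilon>\<^sup>2"
proof -
  let ?D = "differences F - {0}" and ?E = "\<lambda>\<omega>. U g \<omega> \<and> \<not> R g \<omega>"
  have finD: "finite ?D" using finite_differences[OF F(1)] by simp
  have sE: "simple_function \<Omega> ?E"
  proof (rule simple_function_determined)
    show "simple_function \<Omega> (\<lambda>\<omega>. (U g \<omega>, R g \<omega>))" by (intro simple_function_Pair simple_U simple_R)
  qed simp
  have lev: "{\<omega> \<in> space \<Omega>. snd \<omega> g \<and> snd \<omega> h} \<in> sets \<Omega>" for h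
    using simple_function_level[OF simple_function_Pair[OF simple_xi[of g] simple_xi[of h]], of "(True, True)"]
    by simp
  have "measure \<Omega> {\<omega> \<in> space \<Omega>. ?E \<omega>} \<le> measure \<Omega> (\<Union>d\<in>?D. {\<omega> \<in> space \<Omega>. snd \<omega> g \<and> snd \<omega> (g + d)})"
    using lev finD by (intro \<Omega>.finite_measure_mono) (auto simp: U_def R_def site_def)
  also have "\<dots> \<le> (\<Sum>d\<in>?D. measure \<Omega> {\<omega> \<in> space \<Omega>. snd \<omega> g \<and> snd \<omega> (g + d)})"
    using lev finD by (intro \<Omega>.finite_measure_subadditive_finite) auto
  also have "\<dots> = (\<Sum>d\<in>?D. \<epsilon>\<^sup>2)"
    by (intro sum.cong refl measure_xi_xi) (metis DiffD2 add.right_neutral add_left_cancel singletonI)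
  also have "\<dots> \<le> num_diff * \<epsilon>\<^sup>2"
    unfolding num_diff_def using finite_differences[OF F(1)] by (simp add: card_mono mult_right_mono)
  finally have m: "measure \<Omega> {\<omega> \<in> space \<Omega>. ?E \<omega>} \<le> num_diff * \<epsilon>\<^sup>2" .
  have "cond_ent \<Omega> (U g) (R g) \<le> cond_ent \<Omega> ?E (R g)"
  proof (rule \<Omega>.cond_ent_mono[OF sE simple_R])
    fix x y assume "(U g x \<and> \<not> R g x) = (U g y \<and> \<not> R g y)" "R g x = R g y"
    moreover have "R g z \<Longrightarrow> U g z" for z by (simp add: R_def U_def site_def)
    ultimately show "U g x = U g y" by blast
  qed
  also have "\<dots> \<le> ent \<Omega> ?E" by (intro \<Omega>.cond_ent_le_ent sE simple_R)
  also have "\<dots> \<le> 4 * sqrt (sqrt (num_diff * \<epsilon>\<^sup>2)) ^ 3 + num_diff * \<epsilon>\<^sup>2"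
    by (rule \<Omega>.ent_pred_le[OF sE m])
  finally show ?thesis .
qed

lemma measure_R: "measure \<Omega> {\<omega> \<in> space \<Omega>. R g \<omega>} \<le> \<epsilon> * freq v"
proof -
  let ?T = "(+) g ` F"
  have finT: "finite ?T" using F by simp
  have s: "simple_function \<Omega> (\<lambda>\<omega>. (restrict (snd \<omega>) {}, restrict (fst \<omega>) ?T))"
    using finT by (intro simple_function_Pair simple_function_restrict_fun) auto
  \<comment> \<open>With no coin revealed, \<open>xi_independent\<close> is applied to the single
    pattern \<open>z\<close>, which is \<open>v\<close> carried to the translate of \<open>F\<close>
    at \<open>g\<close>.\<close>
  define Z where "Z = (\<lambda>\<omega> :: ('g \<Rightarrow> 'a) \<times> ('g \<Rightarrow> bool). (restrict (snd \<omega>) {}, restrict (fst \<omega>) ?T))"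
  define z :: "('g \<Rightarrow> bool) \<times> ('g \<Rightarrow> 'a)" where "z = (\<lambda>_. undefined, restrict (\<lambda>h. v (- g + h)) ?T)"
  have e: "occurs F v (fst \<omega>) g \<longleftrightarrow> Z \<omega> = z" for \<omega>
  proof -
    have "restrict (snd \<omega>) {} = (\<lambda>_. undefined)" by auto
    moreover have "restrict (fst \<omega>) ?T = restrict (\<lambda>h. v (- g + h)) ?T \<longleftrightarrow> occurs F v (fst \<omega>) g"
      by (simp add: restrict_eq_restrict_iff occurs_def add.assoc[symmetric])
    ultimately show ?thesis by (auto simp: Z_def z_def)
  qed
  have "measure \<Omega> {\<omega> \<in> space \<Omega>. R g \<omega>} \<le> measure \<Omega> {\<omega> \<in> space \<Omega>. snd \<omega> g \<and> Z \<omega> = z}"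
  proof (rule \<Omega>.finite_measure_mono)
    show "{\<omega> \<in> space \<Omega>. R g \<omega>} \<subseteq> {\<omega> \<in> space \<Omega>. snd \<omega> g \<and> Z \<omega> = z}"
      unfolding e[symmetric] by (auto simp: R_def site_def)
    show "{\<omega> \<in> space \<Omega>. snd \<omega> g \<and> Z \<omega> = z} \<in> sets \<Omega>"
      using simple_function_level[OF simple_function_Pair[OF simple_xi[of g] s], of "(True, z)"]
      by (simp add: Z_def)
  qed
  also have "\<dots> = \<epsilon> * measure \<Omega> {\<omega> \<in> space \<Omega>. Z \<omega> = z}"
    unfolding Z_def by (rule xi_independent[OF finT]) auto
  also have "\<dots> = \<epsilon> * freq v" unfolding e[symmetric] measure_occurs ..
  finally show ?thesis .
qed

lemma simple_occurs_Y [simp]: "simple_function \<Omega> (\<lambda>\<omega>. occurs F w (Y \<omega>) g)"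
  by (intro simple_occurs simple_Y)

text \<open>A new occurrence of \<open>w\<close> at \<open>g\<close> needs a replaced site whose
  translate of \<open>F\<close> meets the one at \<open>g\<close>, hence a chosen coin at one of
  \<open>num_diff\<close> places.\<close>

lemma measure_occurs_Y:
  "measure \<Omega> {\<omega> \<in> space \<Omega>. occurs F w (Y \<omega>) g} \<le> freq w + num_diff * \<epsilon>"
proof -
  have lx: "{\<omega> \<in> space \<Omega>. occurs F w (fst \<omega>) g} \<in> sets \<Omega>"
    using simple_function_level[OF simple_occurs[where f = fst, OF simple_x], of w g True] by simp
  have lxi: "{\<omega> \<in> space \<Omega>. snd \<omega> h} \<in> sets \<Omega>" for h
    using simple_function_level[OF simple_xi[of h], of True] by simp
  have finD: "finite (differences F)" by (rule finite_differences[OF F(1)])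
  have "{\<omega> \<in> space \<Omega>. occurs F w (Y \<omega>) g} \<subseteq> {\<omega> \<in> space \<Omega>. occurs F w (fst \<omega>) g} \<union>
      (\<Union>d\<in>differences F. {\<omega> \<in> space \<Omega>. snd \<omega> (g + d)})"
  proof safe
    fix x \<xi>
    assume \<omega>: "(x, \<xi>) \<in> space \<Omega>" "occurs F w (Y (x, \<xi>)) g"
      and n: "(x, \<xi>) \<notin> (\<Union>d\<in>differences F. {\<omega> \<in> space \<Omega>. snd \<omega> (g + d)})"
    have "Y (x, \<xi>) (g + f) = x (g + f)" if f: "f \<in> F" for f
    proof -
      have "\<not> R (g + f - f') (x, \<xi>)" if "f' \<in> F" for f'
      proof
        assume "R (g + f - f') (x, \<xi>)"
        then have "\<xi> (g + (f - f'))" using R_xi[of "g + f - f'" "(x, \<xi>)"] by (simp add: add_diff_eq)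
        moreover have "f - f' \<in> differences F" using f that by (force simp: differences_def)
        ultimately show False using n \<omega>(1) by auto
      qed
      then show ?thesis unfolding Y_def by (subst replace_off) auto
    qed
    then show "occurs F w (fst (x, \<xi>)) g" using \<omega>(2) by (simp add: occurs_def)
  qed
  then have "measure \<Omega> {\<omega> \<in> space \<Omega>. occurs F w (Y \<omega>) g}
      \<le> measure \<Omega> ({\<omega> \<in> space \<Omega>. occurs F w (fst \<omega>) g} \<union> (\<Union>d\<in>differences F. {\<omega> \<in> space \<Omega>. snd \<omega> (g + d)}))"
    using lx lxi finD by (intro \<Omega>.finite_measure_mono) auto
  also have "\<dots> \<le> measure \<Omega> {\<omega> \<in> space \<Omega>. occurs F w (fst \<omega>) g}
      + measure \<Omega> (\<Union>d\<in>differences F. {\<omega> \<in> space \<Omega>. snd \<omega> (g + d)})"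
    using lx lxi finD by (intro measure_Un_le) auto
  also have "measure \<Omega> (\<Union>d\<in>differences F. {\<omega> \<in> space \<Omega>. snd \<omega> (g + d)})
      \<le> (\<Sum>d\<in>differences F. measure \<Omega> {\<omega> \<in> space \<Omega>. snd \<omega> (g + d)})"
    using lxi finD by (intro \<Omega>.finite_measure_subadditive_finite) auto
  also have "\<dots> = num_diff * \<epsilon>" by (simp add: measure_xi num_diff_def)
  finally show ?thesis by (simp add: measure_occurs)
qed

text \<open>The bound of \<open>cond_ent_subset_le\<close> for one site of \<open>R\<close> given
  \<open>y\<close>, with r' from \<open>measure_R\<close> and q' from
  \<open>measure_occurs_Y\<close>. The summand \<open>num_diff * \<epsilon>\<close> keeps q' at
  least r' even if \<open>freq w\<close> is 0.\<close>

definition bound :: real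
  where "bound = \<epsilon> * freq v * (1 + ln ((freq w + num_diff * \<epsilon>) / (\<epsilon> * freq v)))"

lemma eps_freq_le: "\<epsilon> * freq v \<le> freq w + num_diff * \<epsilon>"
proof -
  have "\<epsilon> * freq v \<le> \<epsilon> * num_diff" using \<epsilon> freq_bounds(2)[of v] num_diff_ge_1 by (intro mult_left_mono) auto
  then show ?thesis using freq_bounds(1)[of w] by (simp add: mult.commute)
qed

lemma cond_ent_R_occurs_Y:
  assumes "freq v > 0"
  shows "cond_ent \<Omega> (R g) (\<lambda>\<omega>. occurs F w (Y \<omega>) g) \<le> bound"
  unfolding bound_def
proof (rule \<Omega>.cond_ent_subset_le)
  fix \<omega> assume "R g \<omega>"
  then show "occurs F w (Y \<omega>) g"
    unfolding occurs_def Y_def by (intro ballI replace_at[OF separated_R])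
qed (use assms \<epsilon> eps_freq_le measure_R measure_occurs_Y in simp_all)

lemma bound_nonneg: "freq v > 0 \<Longrightarrow> 0 \<le> bound"
  unfolding bound_def using \<epsilon> eps_freq_le
  by (intro mult_nonneg_nonneg add_nonneg_nonneg) (auto simp: le_divide_eq)

text \<open>Per site: the entropy of \<open>U\<close> given \<open>x\<close>, minus the price of
  passing from \<open>U\<close> to \<open>R\<close>, minus the bound for \<open>R\<close> given
  \<open>y\<close>.\<close>

definition gain :: real
  where "gain = freq v * (eta \<epsilon> + eta (1 - \<epsilon>))
    - (4 * sqrt (sqrt (num_diff * \<epsilon>\<^sup>2)) ^ 3 + num_diff * \<epsilon>\<^sup>2) - bound"

section \<open>Comparison of entropies in a finite window\<close>

text \<open>The chain rule is applied to \<open>R\<close> together with \<open>x\<close>, and to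
  \<open>R\<close> together with \<open>y\<close>. \<open>S\<close> contains every site that can
  alter \<Phi>. A site of \<open>S\<close> whose translate of \<open>F\<close> leaves \<Phi> is
  charged 2, since \<open>y\<close> on \<Phi> does not show the whole pattern there.\<close>

lemma joint_ent_Y_ge:
  fixes \<Phi> :: "'g set"
  assumes pos: "freq v > 0" "gain \<ge> 0" and fin: "finite \<Phi>"
  defines "S \<equiv> translates \<Phi> (uminus ` F)"
  shows "joint_ent \<Omega> (\<lambda>g \<omega>. fst \<omega> g) \<Phi> + real (card \<Phi>) * gain - 2 * real (card {g \<in> S. \<not> (+) g ` F \<subseteq> \<Phi>})
    \<le> joint_ent \<Omega> (\<lambda>g \<omega>. Y \<omega> g) \<Phi>"
proof -
  \<comment> \<open>On \<open>T\<close> every occurrence at a site of \<open>S\<close> is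
    visible.\<close>
  define T where "T = \<Phi> \<union> (\<Union>g\<in>S. (+) g ` F)"
  let ?x = "\<lambda>A (\<omega> :: ('g \<Rightarrow> 'a) \<times> ('g \<Rightarrow> bool)). restrict (fst \<omega>) A" and ?xi = "\<lambda>A (\<omega> :: ('g \<Rightarrow> 'a) \<times> ('g \<Rightarrow> bool)). restrict (snd \<omega>) A"
  let ?Y = "\<lambda>A \<omega>. restrict (Y \<omega>) A"
  let ?R = "\<lambda>A \<omega>. restrict (\<lambda>g. R g \<omega>) A" and ?U = "\<lambda>A \<omega>. restrict (\<lambda>g. U g \<omega>) A"
  let ?e = "4 * sqrt (sqrt (num_diff * \<epsilon>\<^sup>2)) ^ 3 + num_diff * \<epsilon>\<^sup>2" and ?h = "eta \<epsilon> + eta (1 - \<epsilon>)"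
  have finS: "finite S" unfolding S_def using fin F by (intro finite_translates) auto
  have finT: "finite T" unfolding T_def using fin finS F by auto
  have sx: "simple_function \<Omega> (?x A)" and sxi: "simple_function \<Omega> (?xi A)"
    and sY: "simple_function \<Omega> (?Y A)" and sR: "simple_function \<Omega> (?R A)"
    and sU: "simple_function \<Omega> (?U A)" if "finite A" for A
    using that by (auto intro!: simple_function_restrict_fun simple_function_restrict)
  have jx: "joint_ent \<Omega> (\<lambda>g \<omega>. fst \<omega> g) \<Phi> = ent \<Omega> (?x \<Phi>)" and jY: "joint_ent \<Omega> (\<lambda>g \<omega>. Y \<omega> g) \<Phi> = ent \<Omega> (?Y \<Phi>)"
    by (simp_all add: joint_ent_def)
  have hS: "h - f \<in> S" if "h \<in> \<Phi>" "f \<in> F" for h f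
  proof -
    have "h - f = h + (- f)" by simp
    then show ?thesis unfolding S_def translates_def using that by blast
  qed
  \<comment> \<open>\<open>y\<close> on \<Phi> and \<open>R\<close> on \<open>S\<close> give back
    \<open>x\<close> on \<Phi>, as \<open>S\<close> contains every \<open>h - f\<close>.\<close>
  have swap: "ent \<Omega> (\<lambda>\<omega>. (?R S \<omega>, ?x \<Phi> \<omega>)) \<le> ent \<Omega> (\<lambda>\<omega>. (?R S \<omega>, ?Y \<Phi> \<omega>))"
  proof (rule \<Omega>.ent_mono)
    show "simple_function \<Omega> (\<lambda>\<omega>. (?R S \<omega>, ?Y \<Phi> \<omega>))" by (intro simple_function_Pair sR sY finS fin)
    fix \<omega> \<omega>' assume e: "(?R S \<omega>, ?Y \<Phi> \<omega>) = (?R S \<omega>', ?Y \<Phi> \<omega>')"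
    have "fst \<omega> h = fst \<omega>' h" if h: "h \<in> \<Phi>" for h
    proof -
      have "replace F v (\<lambda>g. R g \<omega>) (Y \<omega>) h = replace F v (\<lambda>g. R g \<omega>') (Y \<omega>') h"
        using e h hS[OF h] by (intro replace_cong_local) (auto simp: restrict_eq_restrict_iff)
      then show ?thesis by (simp only: replace_Y)
    qed
    then show "(?R S \<omega>, ?x \<Phi> \<omega>) = (?R S \<omega>', ?x \<Phi> \<omega>')" using e by (simp add: restrict_eq_restrict_iff)
  qed
  have upper: "cond_ent \<Omega> (?R S) (?Y \<Phi>) \<le> real (card S) * bound + 2 * real (card {g \<in> S. \<not> (+) g ` F \<subseteq> \<Phi>})"
  proof -
    have "cond_ent \<Omega> (?R S) (?Y \<Phi>) \<le> (\<Sum>g\<in>S. cond_ent \<Omega> (R g) (?Y \<Phi>))"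
      by (rule \<Omega>.cond_ent_restrict_le_sum[OF finS simple_R sY[OF fin]])
    also have "\<dots> \<le> (\<Sum>g\<in>S. bound + (if \<not> (+) g ` F \<subseteq> \<Phi> then 2 else 0))"
    proof (rule sum_mono)
      fix g
      show "cond_ent \<Omega> (R g) (?Y \<Phi>) \<le> bound + (if \<not> (+) g ` F \<subseteq> \<Phi> then 2 else 0)"
      proof (cases "(+) g ` F \<subseteq> \<Phi>")
        case True
        have "cond_ent \<Omega> (R g) (?Y \<Phi>) \<le> cond_ent \<Omega> (R g) (\<lambda>\<omega>. occurs F w (Y \<omega>) g)"
          using True by (intro \<Omega>.cond_ent_mono_cond simple_R sY fin simple_occurs_Y)
            (force simp: restrict_eq_restrict_iff occurs_def)
        also have "\<dots> \<le> bound" by (rule cond_ent_R_occurs_Y[OF pos(1)])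
        finally show ?thesis using True by simp
      next
        case False
        have "cond_ent \<Omega> (R g) (?Y \<Phi>) \<le> ent \<Omega> (R g)" by (intro \<Omega>.cond_ent_le_ent simple_R sY fin)
        \<comment> \<open>The constant 2 is the number of truth values.\<close>
        also have "\<dots> \<le> real (card (UNIV :: bool set))" by (intro \<Omega>.ent_le_card simple_R) auto
        finally show ?thesis using False bound_nonneg[OF pos(1)] by simp
      qed
    qed
    also have "\<dots> = real (card S) * bound + 2 * real (card {g \<in> S. \<not> (+) g ` F \<subseteq> \<Phi>})"
      using finS by (simp add: sum.distrib sum.If_cases Int_def)
    finally show ?thesis .
  qed
  have lower: "real (card S) * (freq v * ?h - ?e) \<le> cond_ent \<Omega> (?R S) (?x \<Phi>)"
  proof -
    have "real (card S) * (freq v * ?h) \<le> cond_ent \<Omega> (?U S) (?x T)"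
    proof (rule \<Omega>.cond_ent_restrict_ge[OF finS simple_U sx[OF finT]])
      fix g assume g: "g \<in> S"
      have "freq v * ?h = cond_ent \<Omega> (U g) (\<lambda>\<omega>. (?xi (S - {g}) \<omega>, ?x T \<omega>))"
        using finS finT g by (intro cond_ent_U[symmetric]) (auto simp: T_def)
      \<comment> \<open>Given \<open>x\<close> on \<open>T\<close>, the coins determine
        \<open>U\<close>; conditioning on \<open>U\<close> instead can only raise the
        entropy.\<close>
      also have "\<dots> \<le> cond_ent \<Omega> (U g) (\<lambda>\<omega>. (?U (S - {g}) \<omega>, ?x T \<omega>))"
      proof (rule \<Omega>.cond_ent_mono_cond)
        fix \<omega> \<omega>' assume e: "(?xi (S - {g}) \<omega>, ?x T \<omega>) = (?xi (S - {g}) \<omega>', ?x T \<omega>')"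
        have "U k \<omega> = U k \<omega>'" if k: "k \<in> S - {g}" for k
        proof -
          have "snd \<omega> k = snd \<omega>' k" using e k by (simp add: restrict_eq_restrict_iff)
          moreover have "fst \<omega> (k + f) = fst \<omega>' (k + f)" if "f \<in> F" for f
            using e k that by (auto simp: restrict_eq_restrict_iff T_def)
          ultimately show ?thesis by (simp add: U_def occurs_def)
        qed
        then show "(?U (S - {g}) \<omega>, ?x T \<omega>) = (?U (S - {g}) \<omega>', ?x T \<omega>')"
          using e by (simp add: restrict_eq_restrict_iff)
      qed (use finS finT in \<open>auto intro!: simple_function_Pair sxi sx sU\<close>)
      finally show "freq v * ?h \<le> cond_ent \<Omega> (U g) (\<lambda>\<omega>. (?U (S - {g}) \<omega>, ?x T \<omega>))" .
    qed
    \<comment> \<open>Pass from \<open>U\<close> to \<open>R\<close>: once \<open>R\<close> is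
      known, \<open>U\<close> costs at most \<open>?e\<close> per site.\<close>
    also have "\<dots> \<le> cond_ent \<Omega> (\<lambda>\<omega>. (?U S \<omega>, ?R S \<omega>)) (?x T)"
      by (intro \<Omega>.cond_ent_mono simple_function_Pair sU sR sx finS finT) simp
    also have "\<dots> = cond_ent \<Omega> (?R S) (?x T) + cond_ent \<Omega> (?U S) (\<lambda>\<omega>. (?R S \<omega>, ?x T \<omega>))"
      by (intro \<Omega>.cond_ent_chain sU sR sx finS finT)
    also have "cond_ent \<Omega> (?R S) (?x T) \<le> cond_ent \<Omega> (?R S) (?x \<Phi>)"
      by (intro \<Omega>.cond_ent_mono_cond sR sx finS finT fin) (auto simp: restrict_eq_restrict_iff T_def)
    also have "cond_ent \<Omega> (?U S) (\<lambda>\<omega>. (?R S \<omega>, ?x T \<omega>)) \<le> (\<Sum>g\<in>S. cond_ent \<Omega> (U g) (\<lambda>\<omega>. (?R S \<omega>, ?x T \<omega>)))"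
      by (intro \<Omega>.cond_ent_restrict_le_sum finS simple_U simple_function_Pair sR sx finT)
    also have "\<dots> \<le> (\<Sum>g\<in>S. ?e)"
    proof (rule sum_mono)
      fix g assume g: "g \<in> S"
      have "cond_ent \<Omega> (U g) (\<lambda>\<omega>. (?R S \<omega>, ?x T \<omega>)) \<le> cond_ent \<Omega> (U g) (R g)"
        using g by (intro \<Omega>.cond_ent_mono_cond simple_U simple_R simple_function_Pair sR sx finS finT)
          (simp add: restrict_eq_restrict_iff)
      also have "\<dots> \<le> ?e" by (rule cond_ent_U_R)
      finally show "cond_ent \<Omega> (U g) (\<lambda>\<omega>. (?R S \<omega>, ?x T \<omega>)) \<le> ?e" .
    qed
    finally show ?thesis unfolding right_diff_distrib sum_constant by linarith
  qed
  \<comment> \<open>As \<open>gain\<close> is nonnegative, the number of sites may be lowered from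
    \<open>card S\<close> to \<open>card \<Phi>\<close>.\<close>
  have "card \<Phi> \<le> card S"
  proof -
    obtain f where f: "f \<in> F" using F by blast
    have "inj_on (\<lambda>h. h - f) \<Phi>" by (auto simp: inj_on_def)
    then have "card \<Phi> = card ((\<lambda>h. h - f) ` \<Phi>)" by (simp add: card_image)
    also have "\<dots> \<le> card S" using hS[OF _ f] finS by (intro card_mono) auto
    finally show ?thesis .
  qed
  then have "real (card \<Phi>) * gain \<le> real (card S) * gain" using pos by (intro mult_right_mono) auto
  then have "real (card \<Phi>) * gain \<le> real (card S) * (freq v * ?h - ?e) - real (card S) * bound"
    by (simp add: gain_def right_diff_distrib)
  then show ?thesis using swap upper lower unfolding jx jY cond_ent_def by linarith
qed

end

section \<open>The choice of epsilon\<close>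

text \<open>Here \<open>a\<close> and \<open>b\<close> stand for the measures of \<open>v\<close>
  and \<open>w\<close>, and \<open>C\<close> for \<open>num_diff\<close>. The terms with
  \<open>ln \<epsilon>\<close> cancel; after division by \<epsilon> at least \<open>L\<close>
  remains, up to terms that vanish with \<epsilon>.\<close>

lemma gain_positive:
  fixes a b C :: real
  assumes ab: "0 \<le> b" "b < a" and C: "0 < C"
  obtains \<epsilon> where "0 < \<epsilon>" "\<epsilon> < 1"
    "a * (eta \<epsilon> + eta (1 - \<epsilon>)) - (4 * sqrt (sqrt (C * \<epsilon>\<^sup>2)) ^ 3 + C * \<epsilon>\<^sup>2)
      - \<epsilon> * a * (1 + ln ((b + C * \<epsilon>) / (\<epsilon> * a))) > 0"
proof -
  \<comment> \<open>The midpoint is positive even if \<open>b = 0\<close>, and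
    \<open>b + C * \<epsilon>\<close> stays below it for small \<epsilon>; so \<open>ln m\<close>
    can bound the numerator where \<open>ln b\<close> could not.\<close>
  define m where "m = (a + b) / 2"
  define L where "L = a * (ln a - ln m)"
  have m: "0 < m" "m < a" "b < m" using ab by (auto simp: m_def)
  have a: "a > 0" using ab by simp
  have L: "L > 0" unfolding L_def using m by simp
  have "((\<lambda>e. a * e + C * e + 4 * sqrt (sqrt C) ^ 3 * sqrt e) \<longlongrightarrow> a * 0 + C * 0 + 4 * sqrt (sqrt C) ^ 3 * sqrt 0) (at_right 0)"
    by (intro tendsto_intros)
  then have 1: "\<forall>\<^sub>F e in at_right 0. a * e + C * e + 4 * sqrt (sqrt C) ^ 3 * sqrt e < L"
    using L by (intro order_tendstoD) auto
  have "((\<lambda>e. b + C * e) \<longlongrightarrow> b + C * 0) (at_right 0)" by (intro tendsto_intros)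
  then have 2: "\<forall>\<^sub>F e in at_right 0. b + C * e < m" using m(3) by (intro order_tendstoD(2)) (assumption, simp)
  have 3: "\<forall>\<^sub>F e in at_right (0::real). 0 < e \<and> e < 1"
    using eventually_at_right_real[of 0 1] by (auto elim: eventually_mono)
  have "\<forall>\<^sub>F e in at_right 0. a * e + C * e + 4 * sqrt (sqrt C) ^ 3 * sqrt e < L \<and> b + C * e < m \<and> 0 < e \<and> e < 1"
    using 1 2 3 by eventually_elim blast
  then obtain e where e: "a * e + C * e + 4 * sqrt (sqrt C) ^ 3 * sqrt e < L" "b + C * e < m" "0 < e" "e < 1"
    using eventually_happens[of _ "at_right (0::real)"] by auto
  have "ln (1 - e) \<le> - e" using e ln_le_minus_one[of "1 - e"] by simp
  then have "(1 - e) * e \<le> (1 - e) * (- ln (1 - e))" using e by (intro mult_left_mono) auto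
  \<comment> \<open>The loss of e^2 here is the source of the term \<open>a * e\<close>
    above.\<close>
  then have h: "e - e\<^sup>2 \<le> eta (1 - e)" by (simp add: eta_def algebra_simps power2_eq_square)
  \<comment> \<open>A full factor \<open>e\<close> comes out, and the remaining
    \<open>sqrt e\<close> tends to 0.\<close>
  have r: "sqrt (sqrt (C * e\<^sup>2)) ^ 3 = e * (sqrt (sqrt C) ^ 3 * sqrt e)"
  proof -
    have "sqrt (sqrt (C * e\<^sup>2)) = sqrt (sqrt C) * sqrt e"
      using e by (simp add: real_sqrt_mult)
    moreover have "sqrt e ^ 3 = e * sqrt e" using e by (simp add: power3_eq_cube)
    ultimately show ?thesis by (simp add: power_mult_distrib)
  qed
  have ln: "ln ((b + C * e) / (e * a)) \<le> ln m - ln e - ln a"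
  proof -
    have "b + C * e > 0" using ab C e by (simp add: add_nonneg_pos)
    then have "ln ((b + C * e) / (e * a)) \<le> ln (m / (e * a))"
      using e a m by (intro ln_mono divide_right_mono divide_pos_pos) auto
    also have "\<dots> = ln m - ln e - ln a" using e a m by (simp add: ln_div ln_mult)
    finally show ?thesis .
  qed
  have "e * a * (1 + ln ((b + C * e) / (e * a))) \<le> e * a * (1 + (ln m - ln e - ln a))"
    using e a ln by (intro mult_left_mono) auto
  moreover have "a * (eta e + (e - e\<^sup>2)) \<le> a * (eta e + eta (1 - e))"
    using h a by (intro mult_left_mono) auto
  moreover have "a * (eta e + (e - e\<^sup>2)) - (4 * (e * (sqrt (sqrt C) ^ 3 * sqrt e)) + C * e\<^sup>2)
      - e * a * (1 + (ln m - ln e - ln a))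
      = e * (L - (a * e + C * e + 4 * sqrt (sqrt C) ^ 3 * sqrt e))"
    by (simp add: L_def eta_def algebra_simps power2_eq_square)
  moreover have "e * (L - (a * e + C * e + 4 * sqrt (sqrt C) ^ 3 * sqrt e)) > 0"
    using e by (intro mult_pos_pos) auto
  ultimately show ?thesis using e by (intro that[of e]) (simp_all only: r)
qed

section \<open>Passage to the limit and conclusion\<close>

context random_replacement
begin

lemma joint_ent_\<nu>:
  assumes "finite S"
  shows "joint_ent \<nu> (\<lambda>g x. x g) S = joint_ent \<Omega> (\<lambda>g \<omega>. Y \<omega> g) S"
  unfolding joint_ent_def \<nu>_def
  by (rule ent_distr[OF measurable_Y]) (intro simple_function_restrict simple_coordinate assms)

lemma joint_ent_\<mu>:
  assumes "finite S"
  shows "joint_ent \<mu> (\<lambda>g x. x g) S = joint_ent \<Omega> (\<lambda>g \<omega>. fst \<omega> g) S"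
proof -
  have "joint_ent \<mu> (\<lambda>g x. x g) S = joint_ent (distr \<Omega> \<mu> fst) (\<lambda>g x. x g) S" by (simp only: distr_fst)
  also have "\<dots> = joint_ent \<Omega> (\<lambda>g \<omega>. fst \<omega> g) S"
    unfolding joint_ent_def
    by (rule ent_distr[OF measurable_fst_\<Omega>]) (intro simple_function_restrict simple_coordinate assms)
  finally show ?thesis .
qed

text \<open>If \<open>g = h - f'\<close> and \<open>g + f\<close> is outside \<Phi>, then
  \<open>g + f\<close> is \<open>h + (- f' + f)\<close>, a point of the enlarged window outside
  \<Phi>. This point and \<open>f\<close> determine \<open>g\<close>.\<close>

lemma boundary_card:
  fixes \<Phi> :: "'g set"
  assumes fin: "finite \<Phi>"
  shows "card {g \<in> translates \<Phi> (uminus ` F). \<not> (+) g ` F \<subseteq> \<Phi>}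
    \<le> card F * card (translates \<Phi> ((\<lambda>(f, f'). - f' + f) ` (F \<times> F)) - \<Phi>)"
proof -
  let ?D = "translates \<Phi> ((\<lambda>(f, f'). - f' + f) ` (F \<times> F)) - \<Phi>"
  have finD: "finite ?D" using fin F by (intro finite_Diff finite_translates) auto
  have "{g \<in> translates \<Phi> (uminus ` F). \<not> (+) g ` F \<subseteq> \<Phi>} \<subseteq> (\<Union>f\<in>F. (\<lambda>u. u - f) ` ?D)"
  proof
    fix g assume g: "g \<in> {g \<in> translates \<Phi> (uminus ` F). \<not> (+) g ` F \<subseteq> \<Phi>}"
    then obtain h f' where h: "h \<in> \<Phi>" "f' \<in> F" "g = h + - f'" by (auto simp: translates_def)
    from g obtain f where f: "f \<in> F" "g + f \<notin> \<Phi>" by auto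
    have "g + f = h + (- f' + f)" unfolding h(3) by (simp only: add.assoc)
    then have "g + f \<in> ?D" using h f unfolding translates_def by blast
    moreover have "g = g + f - f" by simp
    ultimately show "g \<in> (\<Union>f\<in>F. (\<lambda>u. u - f) ` ?D)" using f by blast
  qed
  then have "card {g \<in> translates \<Phi> (uminus ` F). \<not> (+) g ` F \<subseteq> \<Phi>} \<le> card (\<Union>f\<in>F. (\<lambda>u. u - f) ` ?D)"
    using F finD by (intro card_mono) auto
  also have "\<dots> \<le> (\<Sum>f\<in>F. card ((\<lambda>u. u - f) ` ?D))" using F by (intro card_UN_le) auto
  also have "\<dots> \<le> (\<Sum>f\<in>F. card ?D)" using finD by (intro sum_mono card_image_le)
  finally show ?thesis by simp
qed

lemma ks_entropy_\<nu>_ge: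
  fixes \<Phi> :: "nat \<Rightarrow> 'g set"
  assumes pos: "freq v > 0" "gain \<ge> 0" and \<Phi>: "folner_sequence \<Phi>"
  shows "ks_entropy \<mu> + ereal gain \<le> ks_entropy \<nu>"
proof -
  interpret \<nu>: invariant_subshift X \<nu>
    using subshift invariant_\<nu> by unfold_locales
  let ?K = "(\<lambda>(f, f'). - f' + f) ` (F \<times> F)"
  let ?d = "\<lambda>n. real (card (translates (\<Phi> n) ?K - \<Phi> n)) / real (card (\<Phi> n))"
  have fin: "finite (\<Phi> n)" "\<Phi> n \<noteq> {}" for n using \<Phi> by (auto simp: folner_sequence_def)
  have c0: "real (card (\<Phi> n)) > 0" for n using fin[of n] by (simp add: card_gt_0_iff)
  have main: "joint_ent \<mu> (\<lambda>g x. x g) (\<Phi> n) / real (card (\<Phi> n)) + gain - 2 * real (card F) * ?d n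
      \<le> joint_ent \<nu> (\<lambda>g x. x g) (\<Phi> n) / real (card (\<Phi> n))" for n
  proof -
    let ?c = "real (card (\<Phi> n))" and ?b = "real (card (translates (\<Phi> n) ?K - \<Phi> n))"
    have "real (card {g \<in> translates (\<Phi> n) (uminus ` F). \<not> (+) g ` F \<subseteq> \<Phi> n}) \<le> real (card F) * ?b"
      using boundary_card[OF fin(1)] unfolding of_nat_mult[symmetric] of_nat_le_iff .
    then have "joint_ent \<mu> (\<lambda>g x. x g) (\<Phi> n) + ?c * gain - 2 * (real (card F) * ?b) \<le> joint_ent \<nu> (\<lambda>g x. x g) (\<Phi> n)"
      using joint_ent_Y_ge[OF pos fin(1)[of n]] unfolding joint_ent_\<nu>[OF fin(1)] joint_ent_\<mu>[OF fin(1)] by linarith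
    then have "(joint_ent \<mu> (\<lambda>g x. x g) (\<Phi> n) + ?c * gain - 2 * (real (card F) * ?b)) / ?c
        \<le> joint_ent \<nu> (\<lambda>g x. x g) (\<Phi> n) / ?c"
      by (rule divide_right_mono) simp
    then show ?thesis using c0[of n] by (simp add: add_divide_distrib diff_divide_distrib)
  qed
  have "(\<lambda>n. joint_ent \<mu> (\<lambda>g x. x g) (\<Phi> n) / real (card (\<Phi> n)) + gain - 2 * real (card F) * ?d n)
      \<longlonglongrightarrow> partition_entropy_rate \<mu> zero_partition + gain - 2 * real (card F) * 0"
    using F by (intro tendsto_intros zero_partition_limit folner_sequence_translates_diff \<Phi>) auto
  from LIMSEQ_le[OF this \<nu>.zero_partition_limit[OF \<Phi>]] main
  have "partition_entropy_rate \<mu> zero_partition + gain \<le> partition_entropy_rate \<nu> \<nu>.zero_partition"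
    by auto
  then show ?thesis by (simp add: ks_entropy_eq[OF \<Phi>] \<nu>.ks_entropy_eq[OF \<Phi>])
qed

end

text \<open>A pattern from the language is \<open>undefined\<close> off \<open>F\<close>, so
  equality with a restriction can be tested on \<open>F\<close> alone.\<close>

lemma cylinder_eq_occurs:
  fixes X :: "('g::group_add \<Rightarrow> 'a) set"
  assumes "u \<in> language F X"
  shows "cylinder X F u = {x \<in> X. occurs F u x 0}"
proof -
  obtain z where u: "u = restrict z F" using assms by (auto simp: language_def)
  show ?thesis unfolding cylinder_def u occurs_def restrict_eq_restrict_iff by auto
qed

theorem corollary3p18:
  fixes X :: "('g::{group_add, countable} \<Rightarrow> 'a::{finite, discrete_topology}) set"
    and F :: "'g set" and v w :: "'g \<Rightarrow> 'a" and \<mu> :: "('g \<Rightarrow> 'a) measure"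
  assumes "amenable TYPE('g)"
    and "subshift X"
    and "finite F"
    and "v \<in> language F X" and "w \<in> language F X"
    and "max_entropy_measure X \<mu>"
    and "extender_set X F v \<subseteq> extender_set X F w"
  shows "measure \<mu> (cylinder X F v) \<le> measure \<mu> (cylinder X F w)"
proof (cases "F = {}")
  \<comment> \<open>Both are the empty pattern. The case is split off because
    \<open>differences F\<close> is then empty and \<open>?C\<close> would be 0.\<close>
  case True
  then have "v = w" using assms(4,5) by (auto simp: language_def)
  then show ?thesis by simp
next
  case False
  obtain \<Phi> :: "nat \<Rightarrow> 'g set" where \<Phi>: "folner_sequence \<Phi>"
    using assms(1) by (auto simp: amenable_def)
  have inv: "invariant_measure X \<mu>"
    and max: "\<And>\<nu>. invariant_measure X \<nu> \<Longrightarrow> ks_entropy \<nu> \<le> ks_entropy \<mu>"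
    using assms(6) by (auto simp: max_entropy_measure_def)
  let ?a = "measure \<mu> {x \<in> X. occurs F v x 0}" and ?b = "measure \<mu> {x \<in> X. occurs F w x 0}"
  let ?C = "real (card (differences F))"
  have C: "?C > 0"
    using False assms(3) finite_differences[OF assms(3)] by (simp add: card_gt_0_iff differences_def)
  have "?a \<le> ?b"
  proof (rule ccontr)
    assume "\<not> ?a \<le> ?b"
    then obtain \<epsilon> where \<epsilon>: "0 < \<epsilon>" "\<epsilon> < 1"
      and gain: "?a * (eta \<epsilon> + eta (1 - \<epsilon>)) - (4 * sqrt (sqrt (?C * \<epsilon>\<^sup>2)) ^ 3 + ?C * \<epsilon>\<^sup>2)
        - \<epsilon> * ?a * (1 + ln ((?b + ?C * \<epsilon>) / (\<epsilon> * ?a))) > 0"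
      using gain_positive[of ?b ?a ?C] C by (auto simp: not_le)
    interpret random_replacement X \<mu> F v w \<epsilon>
      using assms inv False \<epsilon> by unfold_locales
    have g: "gain > 0"
      using gain unfolding gain_def bound_def freq_def num_diff_def .
    have "freq v > 0"
      using \<open>\<not> ?a \<le> ?b\<close> unfolding freq_def by (simp add: not_le) (meson le_less_trans measure_nonneg)
    then have "ks_entropy \<mu> + ereal gain \<le> ks_entropy \<mu>"
      using ks_entropy_\<nu>_ge[OF _ _ \<Phi>] g max[OF invariant_\<nu>] by (meson less_imp_le order.trans)
    \<comment> \<open>By \<open>ks_entropy_eq\<close> the entropy is a real number, so adding a
      positive gain increases it strictly.\<close>
    then show False using g by (simp add: ks_entropy_eq[OF \<Phi>])
  qed
  then show ?thesis by (simp add: cylinder_eq_occurs assms(4,5))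
qed

end
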